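(* Let $G=H_s^r$ be a Cohen–Macaulay Cameron–Walker graph on $n=2r+3s$ vertices. The Gorenstein polytopes of the form $\operatorname{conv}(\mathcal{D}(G,\mathfrak{c}))$ with $\mathfrak{c}\in(\mathbb{Z}_{>0})^n$ are exactly $\mathcal{Q}_n'+(1,\ldots,1)$ (i.e. this polytope occurs, and it is the only one).
   Context: Cohen–Macaulay Cameron–Walker graphs are exactly the graphs $H_s^r$ constructed as follows. Let $r,s\ge1$ and let $H$ be a connected bipartite graph with vertex classes $\{x_1,\ldots,x_r\}\sqcup\{x_{2r+1},\ldots,x_{2r+s}\}$. Then $H_s^r$ is the graph on $\{x_1,\ldots,x_{2r+3s}\}$ such that: the induced subgraph on $\{x_1,\ldots,x_r\}\sqcup\{x_{2r+1},\ldots,x_{2r+s}\}$ is $H$; for each $1\le i\le r$ there is exactly one pendant edge $\{x_i,x_{r+i}\}$ attached to $x_i$; and for each $1\le i\le s$ there is exactly one pendant triangle with vertices $x_{2r+i},x_{2r+s+i},x_{2r+2s+i}$ attached to $x_{2r+i}$. There are no other edges. Let $n\ge 3$ and let $G$ be a finite graph on $V(G)=\{x_1,\ldots,x_n\}$ with no loops, no multiple edges and no isolated vertices. Let $S=K[x_1,\ldots,x_n]$ be the polynomial ring over a field $K$ and let $I(G)\subset S$ be the edge ideal, generated by the monomials $x_ix_j$ with $\{x_i,x_j\}\in E(G)$. For $\mathfrak{c}=(c_1,\ldots,c_n)\in(\mathbb{Z}_{>0})^n$ and an integer $q\ge1$, $(I(G)^q)_{\mathfrak{c}}$ is the ideal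 generated by the monomials $x_1^{a_1}\cdots x_n^{a_n}\in I(G)^q$ with $a_i\le c_i$ for all $i$. Let $\delta_{\mathfrak{c}}(I(G))$ be the largest $q$ with $(I(G)^q)_{\mathfrak{c}}\ne(0)$, and let $\mathcal{B}(G,\mathfrak{c})$ be the minimal set of monomial generators of $(I(G)^{\delta_{\mathfrak{c}}(I(G))})_{\mathfrak{c}}$. Let $\mathcal{D}(G,\mathfrak{c})$ be the set of vectors $(a_1,\ldots,a_n)\in\mathbb{Z}_{\ge0}^n$ such that $x_1^{a_1}\cdots x_n^{a_n}$ divides some $u\in\mathcal{B}(G,\mathfrak{c})$, and let $\operatorname{conv}(\mathcal{D}(G,\mathfrak{c}))\subset\mathbb{R}^n$ be its convex hull. A lattice polytope (all vertices in $\mathbb{Z}^n$) $\mathcal{P}\subset\mathbb{R}^n$ of dimension $n$ is reflexive if the origin lies in its interior and its dual $\mathcal{P}^\vee=\{x\in\mathbb{R}^n:\sum_i x_iy_i\le1\ \forall y\in\mathcal{P}\}$ is a lattice polytope. A lattice polytope $\mathcal{P}\subset\mathbb{R}^n$ of dimension $n$ is Gorenstein if there are an integer $\delta>0$ and $\mathbf{a}\in\mathbb{Z}^n$ such that $\delta\mathcal{P}-\mathbf{a}$ is reflexive. $\mathcal{Q}_n=[0,1]^n\subset\mathbb{R}^n$ is the standard unit cube and $\mathcal{Q}_n'=2\mathcal{Q}_n-(1,\ldots,1)=[-1,1]^n$, so $\mathcal{Q}_n'+(1,\ldots,1)=[0,2]^n$. *)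

theory Defs
  imports "HOL-Analysis.Analysis" "HOL-Library.Poly_Mapping"
begin

subsection \<open>Ideals of a commutative ring\<close>

text \<open>An ideal is a submodule of the ring regarded as a module over itself, so
  \<open>ideal.span B\<close> is the ideal generated by \<open>B\<close>.\<close>

global_interpretation ideal: module "(*) :: 'a::comm_ring_1 \<Rightarrow> 'a \<Rightarrow> 'a"
  by unfold_locales (simp_all add: algebra_simps)

primrec ideal_power :: "'a::comm_ring_1 set \<Rightarrow> nat \<Rightarrow> 'a set" where
  "ideal_power I 0 = UNIV"
| "ideal_power I (Suc q) = ideal.span {f * g | f g. f \<in> I \<and> g \<in> ideal_power I q}"

subsection \<open>Monomials and edge ideals\<close>

text \<open>The polynomial ring over \<open>'k\<close> with one variable for each element of the finite type
  \<open>'n\<close>; it maps exponent vectors to coefficients.\<close>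

type_synonym ('n, 'k) mpoly = "('n \<Rightarrow>\<^sub>0 nat) \<Rightarrow>\<^sub>0 'k"

definition monom_of :: "('n \<Rightarrow>\<^sub>0 nat) \<Rightarrow> ('n, 'k::field) mpoly" where
  "monom_of a = Poly_Mapping.single a 1"

definition variable :: "'n \<Rightarrow> ('n, 'k::field) mpoly" where
  "variable i = monom_of (Poly_Mapping.single i 1)"

text \<open>A graph on the vertex set \<open>UNIV :: 'n set\<close> is given by its set of edges, each
  of which is a set of two vertices.\<close>

definition edge_ideal :: "'n set set \<Rightarrow> ('n, 'k::field) mpoly set" where
  "edge_ideal E = ideal.span {variable i * variable j | i j. {i, j} \<in> E}"

definition bounded_part ::
    "nat ^ 'n \<Rightarrow> ('n::finite, 'k::field) mpoly set \<Rightarrow> ('n, 'k) mpoly set" where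
  "bounded_part c I =
     ideal.span {monom_of a | a. monom_of a \<in> I \<and> (\<forall>i. Poly_Mapping.lookup a i \<le> c $ i)}"

definition delta :: "'k::field itself \<Rightarrow> 'n::finite set set \<Rightarrow> nat ^ 'n \<Rightarrow> nat" where
  "delta _ E c = (GREATEST q. 1 \<le> q \<and>
     bounded_part c (ideal_power (edge_ideal E :: ('n, 'k) mpoly set) q) \<noteq> {0})"

definition is_min_monomial_gens ::
    "('n, 'k::field) mpoly set \<Rightarrow> ('n, 'k) mpoly set \<Rightarrow> bool" where
  "is_min_monomial_gens I B \<longleftrightarrow>
     B \<subseteq> range monom_of \<and> ideal.span B = I \<and> (\<forall>B'. B' \<subset> B \<longrightarrow> ideal.span B' \<noteq> I)"

text \<open>A monomial ideal has exactly one minimal set of monomial generators.\<close>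

definition min_monomial_gens :: "('n, 'k::field) mpoly set \<Rightarrow> ('n, 'k) mpoly set" where
  "min_monomial_gens I = (THE B. is_min_monomial_gens I B)"

definition bounded_gens ::
    "'n::finite set set \<Rightarrow> nat ^ 'n \<Rightarrow> ('n, 'k::field) mpoly set" where
  "bounded_gens E c =
     min_monomial_gens (bounded_part c (ideal_power (edge_ideal E) (delta TYPE('k) E c)))"

definition exponent_vectors ::
    "'k::field itself \<Rightarrow> 'n::finite set set \<Rightarrow> nat ^ 'n \<Rightarrow> (real ^ 'n) set" where
  "exponent_vectors _ E c =
     {\<chi> i. real (Poly_Mapping.lookup a i) | a.
        \<exists>u \<in> (bounded_gens E c :: ('n, 'k) mpoly set). monom_of a dvd u}"

subsection \<open>Lattice polytopes\<close>

definition lattice_point :: "real ^ 'n \<Rightarrow> bool" where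
  "lattice_point v \<longleftrightarrow> (\<forall>i. v $ i \<in> \<int>)"

definition lattice_polytope :: "(real ^ 'n) set \<Rightarrow> bool" where
  "lattice_polytope P \<longleftrightarrow> polytope P \<and> (\<forall>v. v extreme_point_of P \<longrightarrow> lattice_point v)"

definition dual_polytope :: "(real ^ 'n) set \<Rightarrow> (real ^ 'n) set" where
  "dual_polytope P = {x. \<forall>y \<in> P. (\<Sum>i\<in>UNIV. x $ i * y $ i) \<le> 1}"

definition reflexive :: "(real ^ 'n) set \<Rightarrow> bool" where
  "reflexive P \<longleftrightarrow> lattice_polytope P \<and> aff_dim P = int CARD('n) \<and>
     0 \<in> interior P \<and> lattice_polytope (dual_polytope P)"

definition gorenstein :: "(real ^ 'n) set \<Rightarrow> bool" where
  "gorenstein P \<longleftrightarrow> lattice_polytope P \<and> aff_dim P = int CARD('n) \<and>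
     (\<exists>(\<delta>::int) a. \<delta> > 0 \<and> lattice_point a \<and> reflexive ((\<lambda>v. real_of_int \<delta> *\<^sub>R v - a) ` P))"

text \<open>In \<open>real ^ 'n\<close> the constants \<open>0\<close> and \<open>1\<close> are the vectors all of whose entries
  are 0 and 1, respectively.\<close>

definition unit_cube :: "(real ^ 'n) set" where
  "unit_cube = cbox 0 1"

definition centred_cube :: "(real ^ 'n) set" where
  "centred_cube = (\<lambda>v. 2 *\<^sub>R v - 1) ` unit_cube"

subsection \<open>Cohen--Macaulay Cameron--Walker graphs\<close>

definition connected_bipartite :: "'n set \<Rightarrow> 'n set \<Rightarrow> 'n set set \<Rightarrow> bool" where
  "connected_bipartite A B E \<longleftrightarrow>
     A \<inter> B = {} \<and> (\<forall>e\<in>E. \<exists>a\<in>A. \<exists>b\<in>B. e = {a, b}) \<and>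
     (\<forall>u \<in> A \<union> B. \<forall>v \<in> A \<union> B. (u, v) \<in> {(a, b). {a, b} \<in> E}\<^sup>*)"

text \<open>\<open>x\<close> enumerates the vertices and \<open>H\<close> is the edge set of a bipartite graph with classes
  \<open>x ` {1..r}\<close> and \<open>x ` {2 * r+1..2 * r+s}\<close>. The second set consists of the pendant edges, the
  third of the edges of the pendant triangles.\<close>

definition cameron_walker ::
    "(nat \<Rightarrow> 'n) \<Rightarrow> nat \<Rightarrow> nat \<Rightarrow> 'n set set \<Rightarrow> 'n set set" where
  "cameron_walker x r s H =
     H \<union> (\<Union>i\<in>{1..r}. {{x i, x (r + i)}})
       \<union> (\<Union>i\<in>{1..s}. {{x (2 * r + i), x (2 * r + s + i)},
                          {x (2 * r + i), x (2 * r + 2 * s + i)},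
                          {x (2 * r + s + i), x (2 * r + 2 * s + i)}})"

end

theory Submission
  imports Defs
begin

text \<open>The generators in \<open>\<B>(G, c)\<close> are the degree vectors of the maximum multisets of edges in
  which each vertex \<open>i\<close> has degree at most \<open>c\<^sub>i\<close>, so \<open>conv \<D>(G, c)\<close> is a down-closed polytope. If
  \<open>\<delta>P - a\<close> is reflexive, every facet \<open>x(A) \<le> b\<close> with \<open>0/1\<close> normal vector satisfies \<open>\<delta>b = |A| + 1\<close>,
  and the facets \<open>x\<^sub>i \<ge> 0\<close> force \<open>a = (1, ..., 1)\<close>. Exchanging edges in a maximum matching shows
  that every vertex \<open>j\<close> of \<open>G\<close> gives a facet \<open>x\<^sub>j \<le> 2/\<delta>\<close>, so \<open>\<delta> = 1\<close> or \<open>\<delta> = 2\<close>. For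
  \<open>\<delta> = 1\<close>, taking each pendant edge twice and each triangle edge once reaches the vertex
  \<open>(2, ..., 2)\<close>, so the polytope is the cube. For \<open>\<delta> = 2\<close> the polytope would have \<open>0/1\<close> vertices,
  and a triangle with the pendant vertices at the \<open>d \<ge> 1\<close> neighbours of its base vertex gives a
  facet with \<open>b = d + 2\<close> and \<open>|A| = d + 3\<close>, a contradiction.\<close>

text \<open>No face lattice is computed. An inequality is treated as a facet once every linear form
  that is constant on its tight points is a multiple of the normal: down-closure makes the
  coefficients outside \<open>A\<close> vanish, and moving one unit of degree makes those inside
  equal. The 2 in \<open>\<delta> * m = 2\<close> is \<open>card {j} + 1\<close>, where
  \<open>m\<close> is the largest degree of \<open>j\<close> in a maximum matching.

  The obstacle is to find, for a fixed \<open>j\<close>, maximum matchings with degree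
  \<open>m\<close> at \<open>j\<close> that also cover a given \<open>k\<close>. Exchanging one edge
  can fail only if \<open>k\<close> is not adjacent to \<open>j\<close> and all neighbours of
  \<open>k\<close> are neighbours of \<open>j\<close>. In these graphs one such configuration
  remains: \<open>j\<close> is the base vertex of a triangle and \<open>k\<close> is the pendant
  vertex at a neighbour of \<open>j\<close>. Base vertices are therefore treated after all others.
  If a base vertex with \<open>d\<close> neighbours in \<open>V\<close> violated
  \<open>\<delta> * m = 2\<close>, then \<open>m\<close> would be at least the sum of the capacities
  of its \<open>d + 2\<close> neighbours, so \<open>\<delta> * m \<ge> 2 * (d + 2)\<close>; the
  facet that takes the place of the single vertex gives only
  \<open>\<delta> * m \<le> d + 2\<close>.\<close>

definition deg :: "'n set multiset \<Rightarrow> 'n \<Rightarrow> nat" where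
  "deg M i = size (filter_mset (\<lambda>e. i \<in> e) M)"

lemma deg_simps [simp]:
  "deg {#} i = 0"
  "deg (M + N) i = deg M i + deg N i"
  "deg (add_mset e M) i = of_bool (i \<in> e) + deg M i"
  by (simp_all add: deg_def)

text \<open>The b-matchings of combinatorial optimization, with capacities \<open>c\<close>. Edges
  may be repeated, since a power of the edge ideal contains products with repeated factors.\<close>

definition bmatching :: "'n set set \<Rightarrow> nat ^ 'n \<Rightarrow> 'n set multiset \<Rightarrow> bool" where
  "bmatching E c M \<longleftrightarrow> set_mset M \<subseteq> E \<and> (\<forall>i. deg M i \<le> c $ i)"

definition max_bmatching :: "'n set set \<Rightarrow> nat ^ 'n \<Rightarrow> 'n set multiset \<Rightarrow> bool" where
  "max_bmatching E c M \<longleftrightarrow> bmatching E c M \<and> (\<forall>N. bmatching E c N \<longrightarrow> size N \<le> size M)"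

definition loopless :: "'n set set \<Rightarrow> bool" where
  "loopless E \<longleftrightarrow> (\<forall>e\<in>E. card e = 2)"

text \<open>Double counting of incidences. It lets degree sums over vertex sets be compared edge by
  edge.\<close>

lemma sum_deg:
  assumes "finite A"
  shows "(\<Sum>i\<in>A. deg M i) = (\<Sum>e\<in>#M. card (e \<inter> A))"
proof (induction M)
  case (add e M)
  have "(\<Sum>i\<in>A. of_bool (i \<in> e)) = card (e \<inter> A)"
    using assms by (simp add: Int_commute)
  with add show ?case by (simp add: sum.distrib)
qed simp

lemma handshake:
  fixes M :: "'n::finite set multiset"
  assumes "loopless E" "set_mset M \<subseteq> E"
  shows "(\<Sum>i\<in>UNIV. deg M i) = 2 * size M"
proof -
  have "(\<Sum>e\<in>#M. card (e \<inter> UNIV)) = (\<Sum>e\<in>#M. 2)"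
    using assms by (intro arg_cong[where f = sum_mset] image_mset_cong) (auto simp: loopless_def)
  then show ?thesis by (simp add: sum_deg)
qed

lemma bmatching_size_le:
  fixes E :: "'n::finite set set"
  assumes "loopless E" "bmatching E c M"
  shows "2 * size M \<le> (\<Sum>i\<in>UNIV. c $ i)"
  using handshake[OF assms(1), of M] assms(2)
  by (metis bmatching_def sum_mono)

subsection \<open>Monomial ideals\<close>

lemma keys_monom_of [simp]: "Poly_Mapping.keys (monom_of a :: ('n, 'k::field) mpoly) = {a}"
  by (simp add: monom_of_def)

lemma monom_of_mult: "monom_of a * monom_of b = (monom_of (a + b) :: ('n, 'k::field) mpoly)"
  by (simp add: monom_of_def mult_single)

lemma monom_of_nonzero [simp]: "(monom_of a :: ('n, 'k::field) mpoly) \<noteq> 0"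
  by (metis empty_not_insert keys_monom_of keys_zero)

lemma monom_of_dvd_iff:
  "(monom_of a :: ('n, 'k::field) mpoly) dvd monom_of b \<longleftrightarrow> (\<exists>d. b = a + d)"
proof
  assume "(monom_of a :: ('n, 'k) mpoly) dvd monom_of b"
  then obtain f :: "('n, 'k) mpoly" where f: "monom_of b = monom_of a * f" by (elim dvdE)
  have "b \<in> Poly_Mapping.keys (monom_of a * f)" by (simp flip: f)
  then show "\<exists>d. b = a + d" using keys_mult[of "monom_of a" f] by auto
next
  assume "\<exists>d. b = a + d"
  then show "(monom_of a :: ('n, 'k) mpoly) dvd monom_of b" by (auto simp flip: monom_of_mult)
qed

text \<open>The exponents above some element of \<open>X\<close> are closed under shifts, so
  supports stay among them under ideal combinations. The members of \<open>B\<close> may be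
  arbitrary polynomials, because powers of ideals are spanned by products of arbitrary
  elements.\<close>

lemma keys_span_multiples:
  assumes "f \<in> ideal.span B"
    and "\<And>g. g \<in> B \<Longrightarrow> Poly_Mapping.keys g \<subseteq> {b + d | b d. b \<in> X}"
  shows "Poly_Mapping.keys (f :: ('n, 'k::field) mpoly) \<subseteq> {b + d | b d. b \<in> X}"
  using assms(1)
proof (induction rule: ideal.span_induct_alt)
  case (step h g f)
  have "Poly_Mapping.keys (h * g) \<subseteq> {b + d | b d. b \<in> X}"
  proof
    fix a assume "a \<in> Poly_Mapping.keys (h * g)"
    then obtain a1 a2 where "a = a1 + a2" "a2 \<in> Poly_Mapping.keys g"
      using keys_mult[of h g] by auto
    moreover from this obtain b d where "b \<in> X" "a2 = b + d" using assms(2)[OF step(1)] by blast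
    ultimately show "a \<in> {b + d | b d. b \<in> X}" by (metis (mono_tags, lifting) add.left_commute mem_Collect_eq)
  qed
  with step show ?case using Poly_Mapping.keys_add[of "h * g" f] by blast
qed simp

lemma monom_of_in_span_iff:
  "(monom_of a :: ('n, 'k::field) mpoly) \<in> ideal.span (monom_of ` X) \<longleftrightarrow> (\<exists>b\<in>X. \<exists>d. a = b + d)"
proof
  assume "(monom_of a :: ('n, 'k) mpoly) \<in> ideal.span (monom_of ` X)"
  moreover have "Poly_Mapping.keys g \<subseteq> {b + d | b d. b \<in> X}"
    if "g \<in> monom_of ` X" for g :: "('n, 'k) mpoly"
  proof -
    from that obtain b where b: "b \<in> X" "g = monom_of b" by blast
    then have "b + 0 \<in> {b + d | b d. b \<in> X}" by blast
    then show ?thesis by (simp add: b(2))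
  qed
  ultimately have "Poly_Mapping.keys (monom_of a :: ('n, 'k) mpoly) \<subseteq> {b + d | b d. b \<in> X}"
    by (rule keys_span_multiples)
  then show "\<exists>b\<in>X. \<exists>d. a = b + d" by auto
next
  assume "\<exists>b\<in>X. \<exists>d. a = b + d"
  then obtain b d where "b \<in> X" and a: "a = d + b" by (auto simp: add.commute)
  then show "(monom_of a :: ('n, 'k) mpoly) \<in> ideal.span (monom_of ` X)"
    unfolding a monom_of_mult[symmetric] by (intro ideal.span_scale ideal.span_base) auto
qed

lemma min_monomial_gens_antichain:
  fixes X :: "('n \<Rightarrow>\<^sub>0 nat) set"
  assumes antichain: "\<And>a d. a \<in> X \<Longrightarrow> a + d \<in> X \<Longrightarrow> d = 0"
  shows "min_monomial_gens (ideal.span (monom_of ` X)) = (monom_of ` X :: ('n, 'k::field) mpoly set)"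
  unfolding min_monomial_gens_def
proof (rule the_equality)
  let ?m = "monom_of :: _ \<Rightarrow> ('n, 'k) mpoly"
  show "is_min_monomial_gens (ideal.span (?m ` X)) (?m ` X)"
    unfolding is_min_monomial_gens_def
  proof (intro conjI allI impI)
    fix B assume B: "B \<subset> ?m ` X"
    then obtain Y where Y: "Y \<subseteq> X" "B = ?m ` Y" by (meson psubset_imp_subset subset_imageE)
    with B obtain a where a: "a \<in> X" "a \<notin> Y" by auto
    show "ideal.span B \<noteq> ideal.span (?m ` X)"
    proof
      assume "ideal.span B = ideal.span (?m ` X)"
      then have "?m a \<in> ideal.span (?m ` Y)" using a Y by (auto intro: ideal.span_base)
      then obtain b d where "b \<in> Y" "a = b + d" by (auto simp: monom_of_in_span_iff)
      with a Y antichain[of b d] show False by auto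
    qed
  qed auto
  fix B assume "is_min_monomial_gens (ideal.span (?m ` X)) B"
  then have B: "B \<subseteq> range ?m" "ideal.span B = ideal.span (?m ` X)"
    and min: "\<And>B'. B' \<subset> B \<Longrightarrow> ideal.span B' \<noteq> ideal.span (?m ` X)"
    by (auto simp: is_min_monomial_gens_def)
  then obtain Y where Y: "B = ?m ` Y" by (auto simp: subset_image_iff)
  have "X \<subseteq> Y"
  proof
    fix a assume a: "a \<in> X"
    have "?m a \<in> ideal.span (?m ` Y)" using a B Y by (auto intro: ideal.span_base)
    then obtain b d where b: "b \<in> Y" "a = b + d" by (auto simp: monom_of_in_span_iff)
    have "?m b \<in> ideal.span (?m ` X)" using b B Y by (auto intro: ideal.span_base)
    then obtain b' d' where b': "b' \<in> X" "b = b' + d'" by (auto simp: monom_of_in_span_iff)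
    have "d' + d = 0" using antichain[OF b'(1), of "d' + d"] a b b' by (simp add: add.assoc)
    then have "d = 0" by (metis add_is_0 lookup_add lookup_zero poly_mapping_eqI)
    with b show "a \<in> Y" by simp
  qed
  with Y min show "B = ?m ` X" by (metis image_mono psubsetI)
qed

subsection \<open>Powers of edge ideals\<close>

definition deg_pm :: "'n::finite set multiset \<Rightarrow> ('n \<Rightarrow>\<^sub>0 nat)" where
  "deg_pm M = Poly_Mapping.Abs_poly_mapping (deg M)"

lemma lookup_deg_pm [simp]: "Poly_Mapping.lookup (deg_pm M) = deg M"
  by (simp add: deg_pm_def Abs_poly_mapping_inverse)

lemma deg_pm_simps:
  "deg_pm {#} = 0"
  "i \<noteq> j \<Longrightarrow> deg_pm (add_mset {i, j} M) = Poly_Mapping.single i 1 + Poly_Mapping.single j 1 + deg_pm M"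
  by (auto intro!: poly_mapping_eqI simp: lookup_add lookup_single when_def)

lemma variable_mult:
  "variable i * variable j =
     (monom_of (Poly_Mapping.single i 1 + Poly_Mapping.single j 1) :: ('n, 'k::field) mpoly)"
  by (simp add: variable_def monom_of_mult)

lemma edges_times_power:
  assumes "set_mset M \<subseteq> E" "loopless E"
  shows "(monom_of (deg_pm M) :: ('n::finite, 'k::field) mpoly) \<in> ideal_power (edge_ideal E) (size M)"
  using assms(1)
proof (induction M)
  case (add e M)
  with assms(2) have "card e = 2" by (auto simp: loopless_def)
  then obtain i j where e: "e = {i, j}" "i \<noteq> j" by (auto simp: card_2_iff)
  have "variable i * variable j \<in> (edge_ideal E :: ('n, 'k) mpoly set)"
    using add.prems e unfolding edge_ideal_def by (intro ideal.span_base) auto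
  moreover have "monom_of (deg_pm M) \<in> (ideal_power (edge_ideal E) (size M) :: ('n, 'k) mpoly set)"
    using add by simp
  ultimately have "variable i * variable j * monom_of (deg_pm M) \<in>
      (ideal_power (edge_ideal E) (Suc (size M)) :: ('n, 'k) mpoly set)"
    unfolding ideal_power.simps by (intro ideal.span_base) blast
  then show ?case
    by (simp only: e deg_pm_simps(2)[OF e(2)] variable_mult monom_of_mult size_add_mset)
qed simp

text \<open>The converse of \<open>edges_times_power\<close> on the level of supports. The induction
  runs over all polynomials of the ideal power, as its recursive definition multiplies arbitrary
  elements.\<close>

lemma keys_ideal_power:
  assumes "loopless E"
  shows "f \<in> ideal_power (edge_ideal E) q \<Longrightarrow> Poly_Mapping.keys (f :: ('n::finite, 'k::field) mpoly)
    \<subseteq> {b + d | b d. b \<in> deg_pm ` {M. set_mset M \<subseteq> E \<and> size M = q}}"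
proof (induction q arbitrary: f)
  case 0
  have "{M. set_mset M \<subseteq> E \<and> size M = 0} = {{#}}" by auto
  then show ?case by (auto simp: deg_pm_simps)
next
  case (Suc q)
  let ?X = "\<lambda>q. deg_pm ` {M. set_mset M \<subseteq> E \<and> size M = q}"
  have edge: "Poly_Mapping.keys g \<subseteq> {b + d | b d. b \<in> ?X 1}"
    if "g \<in> edge_ideal E" for g :: "('n, 'k) mpoly"
    using that unfolding edge_ideal_def
  proof (rule keys_span_multiples)
    fix h :: "('n, 'k) mpoly" assume "h \<in> {variable i * variable j |i j. {i, j} \<in> E}"
    then obtain i j where h: "h = variable i * variable j" "{i, j} \<in> E" by blast
    then have "i \<noteq> j" using assms by (force simp: loopless_def)
    then have "Poly_Mapping.keys h = {deg_pm {#{i, j}#}}"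
      by (simp add: h variable_mult deg_pm_simps)
    moreover have "deg_pm {#{i, j}#} \<in> ?X 1" using h(2) by (intro imageI) auto
    then have "deg_pm {#{i, j}#} + 0 \<in> {b + d | b d. b \<in> ?X 1}" by blast
    ultimately show "Poly_Mapping.keys h \<subseteq> {b + d | b d. b \<in> ?X 1}" by simp
  qed
  show ?case
  proof (rule keys_span_multiples)
    show "f \<in> ideal.span {g * h | g h. g \<in> edge_ideal E \<and> h \<in> ideal_power (edge_ideal E) q}"
      using Suc.prems by simp
    fix k :: "('n, 'k) mpoly"
    assume "k \<in> {g * h | g h. g \<in> edge_ideal E \<and> h \<in> ideal_power (edge_ideal E) q}"
    then obtain g h where k: "k = g * h" "g \<in> edge_ideal E" "h \<in> ideal_power (edge_ideal E) q"
      by blast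
    show "Poly_Mapping.keys k \<subseteq> {b + d | b d. b \<in> ?X (Suc q)}"
    proof
      fix a assume "a \<in> Poly_Mapping.keys k"
      then obtain a1 a2 where a: "a = a1 + a2" "a1 \<in> Poly_Mapping.keys g" "a2 \<in> Poly_Mapping.keys h"
        using keys_mult[of g h] k by auto
      obtain M1 d1 where M1: "a1 = deg_pm M1 + d1" "set_mset M1 \<subseteq> E" "size M1 = 1"
        using edge[OF k(2)] a(2) by blast
      obtain M2 d2 where M2: "a2 = deg_pm M2 + d2" "set_mset M2 \<subseteq> E" "size M2 = q"
        using Suc.IH[OF k(3)] a(3) by blast
      have "a = deg_pm (M1 + M2) + (d1 + d2)"
        unfolding a M1 M2 by (intro poly_mapping_eqI) (simp add: lookup_add)
      moreover have "deg_pm (M1 + M2) \<in> ?X (Suc q)" using M1 M2 by (intro imageI) auto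
      ultimately show "a \<in> {b + d | b d. b \<in> ?X (Suc q)}" by blast
    qed
  qed
qed

lemma pm_le_iff:
  fixes a b :: "'n \<Rightarrow>\<^sub>0 nat"
  shows "(\<exists>d. b = a + d) \<longleftrightarrow> (\<forall>i. Poly_Mapping.lookup a i \<le> Poly_Mapping.lookup b i)"
proof
  assume "\<forall>i. Poly_Mapping.lookup a i \<le> Poly_Mapping.lookup b i"
  then have "b = a + (b - a)" by (intro poly_mapping_eqI) (simp add: lookup_add lookup_minus)
  then show "\<exists>d. b = a + d" ..
qed (auto simp: lookup_add)

text \<open>The capacity bound passes to divisors: if \<open>a\<close> is bounded by
  \<open>c\<close> and lies above \<open>deg M\<close>, then \<open>M\<close> respects the
  capacities too.\<close>

lemma bounded_part_eq:
  fixes E :: "'n::finite set set"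
  assumes "loopless E"
  shows "bounded_part c (ideal_power (edge_ideal E) q) =
    ideal.span ((monom_of :: _ \<Rightarrow> ('n, 'k::field) mpoly) `
      deg_pm ` {M. bmatching E c M \<and> size M = q})"
    (is "_ = ideal.span (?m ` ?X)")
  unfolding bounded_part_def
proof (rule antisym; rule ideal.span_minimal)
  show "?m ` ?X \<subseteq> ideal.span {monom_of a |a. monom_of a \<in> (ideal_power (edge_ideal E) q :: ('n, 'k) mpoly set) \<and>
      (\<forall>i. Poly_Mapping.lookup a i \<le> c $ i)}"
  proof clarify
    fix M assume "bmatching E c M" "q = size M"
    then show "?m (deg_pm M) \<in> ideal.span {monom_of a |a. monom_of a \<in> (ideal_power (edge_ideal E) (size M) :: ('n, 'k) mpoly set) \<and>
        (\<forall>i. Poly_Mapping.lookup a i \<le> c $ i)}"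
      using edges_times_power[OF _ assms, of M, where 'k = 'k]
      by (intro ideal.span_base CollectI exI[of _ "deg_pm M"]) (auto simp: bmatching_def)
  qed
  show "{monom_of a |a. monom_of a \<in> (ideal_power (edge_ideal E) q :: ('n, 'k) mpoly set) \<and>
      (\<forall>i. Poly_Mapping.lookup a i \<le> c $ i)} \<subseteq> ideal.span (?m ` ?X)"
  proof clarify
    fix a assume a: "?m a \<in> ideal_power (edge_ideal E) q" "\<forall>i. Poly_Mapping.lookup a i \<le> c $ i"
    obtain M d where M: "a = deg_pm M + d" "set_mset M \<subseteq> E" "size M = q"
      using keys_ideal_power[OF assms a(1)] by auto
    have "deg M i \<le> c $ i" for i
      using a(2)[rule_format, of i] by (simp add: M lookup_add)
    with M have "deg_pm M \<in> ?X" by (auto simp: bmatching_def)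
    with M show "?m a \<in> ideal.span (?m ` ?X)" by (subst monom_of_in_span_iff) blast
  qed
qed simp_all

lemma bounded_part_nonzero_iff:
  fixes E :: "'n::finite set set"
  assumes "loopless E"
  shows "bounded_part c (ideal_power (edge_ideal E :: ('n, 'k::field) mpoly set) q) \<noteq> {0} \<longleftrightarrow>
    (\<exists>M. bmatching E c M \<and> size M = q)"
proof -
  have "ideal.span B = {0} \<longleftrightarrow> B \<subseteq> {0}" for B :: "('n, 'k) mpoly set"
    using ideal.span_superset[of B] ideal.span_minimal[of B "{0}"] ideal.span_zero[of B] by auto
  then have "bounded_part c (ideal_power (edge_ideal E :: ('n, 'k) mpoly set) q) = {0} \<longleftrightarrow>
      monom_of ` deg_pm ` {M. bmatching E c M \<and> size M = q} \<subseteq> {0 :: ('n, 'k) mpoly}"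
    by (simp only: bounded_part_eq[OF assms])
  moreover have "monom_of ` X \<subseteq> {0 :: ('n, 'k) mpoly} \<longleftrightarrow> X = {}" for X
    by (auto simp: image_subset_iff)
  ultimately show ?thesis by simp
qed

text \<open>\<open>M\<close> is nonempty because \<open>delta\<close> ranges over
  \<open>q \<ge> 1\<close> only.\<close>

lemma delta_eq:
  fixes E :: "'n::finite set set"
  assumes "loopless E" "max_bmatching E c M" "M \<noteq> {#}"
  shows "delta TYPE('k::field) E c = size M"
  unfolding delta_def bounded_part_nonzero_iff[OF assms(1)]
  using assms(2,3) by (intro Greatest_equality) (auto simp: max_bmatching_def Suc_le_eq nonempty_has_size)

definition down_set :: "('n::finite \<Rightarrow> nat) set \<Rightarrow> (real ^ 'n) set" where
  "down_set X = {\<chi> i. real (a i) | a. \<exists>f\<in>X. \<forall>i. a i \<le> f i}"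

text \<open>All maximum matchings have the same size, hence by \<open>handshake\<close> degree
  vectors with the same coordinate sum. These form an antichain, so they are the minimal generators.
  From here on the field has disappeared and only matchings remain.\<close>

lemma exponent_vectors_eq:
  fixes E :: "'n::finite set set"
  assumes "loopless E" "max_bmatching E c M0" "M0 \<noteq> {#}"
  shows "exponent_vectors TYPE('k::field) E c = down_set (deg ` {M. max_bmatching E c M})"
proof -
  let ?m = "monom_of :: _ \<Rightarrow> ('n, 'k) mpoly"
  have eq: "{M. bmatching E c M \<and> size M = size M0} = {M. max_bmatching E c M}"
    using assms(2) by (auto simp: max_bmatching_def intro: antisym)
  have "bounded_gens E c = ?m ` deg_pm ` {M. max_bmatching E c M}"
    unfolding bounded_gens_def delta_eq[OF assms] bounded_part_eq[OF assms(1)] eq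
  proof (rule min_monomial_gens_antichain)
    fix a d
    assume "a \<in> deg_pm ` {M. max_bmatching E c M}" "a + d \<in> deg_pm ` {M. max_bmatching E c M}"
    then obtain M N where *: "a = deg_pm M" "a + d = deg_pm N" "max_bmatching E c M" "max_bmatching E c N"
      by auto
    then have "size M = size N" by (auto simp: max_bmatching_def intro: antisym)
    then have "(\<Sum>i\<in>UNIV. deg M i) = (\<Sum>i\<in>UNIV. deg N i)"
      using * by (simp add: handshake[OF assms(1)] max_bmatching_def bmatching_def)
    moreover have "deg N i = deg M i + Poly_Mapping.lookup d i" for i
      using * by (metis lookup_add lookup_deg_pm)
    ultimately have "\<forall>i. Poly_Mapping.lookup d i = 0" by (simp add: sum.distrib)
    then show "d = 0" by (intro poly_mapping_eqI) simp
  qed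
  then have "exponent_vectors TYPE('k) E c = {\<chi> i. real (Poly_Mapping.lookup a i) | a.
      \<exists>M. max_bmatching E c M \<and> (\<forall>i. Poly_Mapping.lookup a i \<le> deg M i)}"
    by (auto simp: exponent_vectors_def monom_of_dvd_iff pm_le_iff)
  also have "\<dots> = down_set (deg ` {M. max_bmatching E c M})" (is "?L = ?R")
  proof
    show "?L \<subseteq> ?R" unfolding down_set_def by auto
    show "?R \<subseteq> ?L"
    proof
      fix z assume "z \<in> ?R"
      then obtain a M where "z = (\<chi> i. real (a i))" "max_bmatching E c M" "\<forall>i. a i \<le> deg M i"
        by (auto simp: down_set_def)
      then show "z \<in> ?L"
        by (intro CollectI exI[of _ "Poly_Mapping.Abs_poly_mapping a"])
          (auto simp: Abs_poly_mapping_inverse)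
    qed
  qed
  finally show ?thesis .
qed

section \<open>Dual polytopes and the facets of reflexive polytopes\<close>

lemma dual_polytope_eq: "dual_polytope Q = {u. \<forall>y\<in>Q. u \<bullet> y \<le> 1}"
  by (simp add: dual_polytope_def inner_vec_def)

lemma convex_dual_polytope: "convex (dual_polytope Q)"
proof -
  have "dual_polytope Q = (\<Inter>y\<in>Q. {u. y \<bullet> u \<le> 1})"
    by (auto simp: dual_polytope_eq inner_commute)
  then show ?thesis by (simp add: convex_INT convex_halfspace_le)
qed

lemma lattice_polytope_convex_hull:
  assumes "finite S" "\<And>v. v \<in> S \<Longrightarrow> lattice_point v"
  shows "lattice_polytope (convex hull S)"
  using assms extreme_point_of_convex_hull
  by (auto simp: lattice_polytope_def polytope_convex_hull)

text \<open>Uniqueness makes \<open>h\<close> an extreme point. If \<open>h\<close> lay strictly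
  between \<open>p\<close> and \<open>q\<close> in the dual, then at each tight \<open>y\<close> a
  weighted mean of \<open>p \<bullet> y\<close> and \<open>q \<bullet> y\<close> would be 1 while
  neither exceeds 1; so both are 1, and \<open>p\<close> and \<open>q\<close> both equal
  \<open>h\<close>.\<close>

lemma dual_facet_lattice_point:
  assumes "lattice_polytope (dual_polytope Q)" "h \<in> dual_polytope Q"
    and unique: "\<And>u. \<forall>y\<in>Q. h \<bullet> y = 1 \<longrightarrow> u \<bullet> y = 1 \<Longrightarrow> u = h"
  shows "lattice_point h"
proof -
  have "h \<notin> open_segment p q" if pq: "p \<in> dual_polytope Q" "q \<in> dual_polytope Q" for p q
  proof
    assume "h \<in> open_segment p q"
    then obtain t where t: "0 < t" "t < 1" "h = (1 - t) *\<^sub>R p + t *\<^sub>R q" and "p \<noteq> q"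
      by (auto simp: in_segment)
    have "p \<bullet> y = 1 \<and> q \<bullet> y = 1" if y: "y \<in> Q" "h \<bullet> y = 1" for y
    proof -
      have le: "p \<bullet> y \<le> 1" "q \<bullet> y \<le> 1" using pq y by (auto simp: dual_polytope_eq)
      have "(1 - t) * (1 - p \<bullet> y) + t * (1 - q \<bullet> y) = 0"
        using y(2) unfolding t(3) by (simp add: inner_simps algebra_simps)
      moreover have "(1 - t) * (1 - p \<bullet> y) \<ge> 0" "t * (1 - q \<bullet> y) \<ge> 0" using le t by auto
      ultimately have "(1 - t) * (1 - p \<bullet> y) = 0" "t * (1 - q \<bullet> y) = 0" by linarith+
      with t show ?thesis by auto
    qed
    then have "p = h" "q = h" using unique by blast+
    with \<open>p \<noteq> q\<close> show False by simp
  qed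
  with assms show ?thesis by (simp add: lattice_polytope_def extreme_point_of_def)
qed

text \<open>The points on the facet determine its normal, so \<open>g / \<kappa>\<close> is a vertex of the dual polytope.
  Hence \<open>1 / \<kappa>\<close> is an integer, as is \<open>\<kappa>\<close>.\<close>

lemma gorenstein_facet:
  fixes D :: "(real ^ 'n) set" and \<delta> :: int and \<beta> :: real
  assumes refl: "reflexive ((\<lambda>v. real_of_int \<delta> *\<^sub>R v - a) ` (convex hull D))"
    and "\<delta> > 0" "lattice_point a" "lattice_point g" "\<bar>g $ j\<bar> = 1" "\<beta> \<in> \<int>"
    and le: "\<And>z. z \<in> D \<Longrightarrow> g \<bullet> z \<le> \<beta>" and z0: "z0 \<in> D" "g \<bullet> z0 = \<beta>"
    and unique: "\<And>u \<gamma>. \<forall>z\<in>D. g \<bullet> z = \<beta> \<longrightarrow> u \<bullet> z = \<gamma> \<Longrightarrow> \<exists>l. u = l *\<^sub>R g"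
  shows "\<delta> * \<beta> - g \<bullet> a = 1"
proof -
  define \<kappa> where "\<kappa> = \<delta> * \<beta> - g \<bullet> a"
  let ?Q = "(\<lambda>v. real_of_int \<delta> *\<^sub>R v - a) ` (convex hull D)"
  have "convex hull D \<subseteq> {v. g \<bullet> v \<le> \<beta>}"
    using le by (intro hull_minimal) (auto simp: convex_halfspace_le)
  then have leQ: "g \<bullet> y \<le> \<kappa>" if "y \<in> ?Q" for y
    using that \<open>\<delta> > 0\<close> by (auto simp: \<kappa>_def inner_simps)
  have "g \<noteq> 0" using \<open>\<bar>g $ j\<bar> = 1\<close> by auto
  obtain e where e: "e > 0" "cball 0 e \<subseteq> ?Q"
    using refl by (auto simp: reflexive_def mem_interior_cball)
  \<comment> \<open>A point of the ball around the origin, taken in the direction of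
    \<open>g\<close>, has positive value under \<open>g\<close>. This forces
    \<open>\<kappa> > 0\<close> and permits division by \<open>\<kappa>\<close>.\<close>
  have "(e / norm g) *\<^sub>R g \<in> ?Q" using e \<open>g \<noteq> 0\<close> by (intro subsetD[OF e(2)]) auto
  from leQ[OF this] have "e * norm g \<le> \<kappa>"
    using \<open>g \<noteq> 0\<close> by (simp add: dot_square_norm power2_eq_square)
  then have "\<kappa> > 0" using e \<open>g \<noteq> 0\<close> by (smt (verit) mult_pos_pos zero_less_norm_iff)
  have "lattice_point ((1 / \<kappa>) *\<^sub>R g)"
  proof (rule dual_facet_lattice_point)
    show "lattice_polytope (dual_polytope ?Q)" using refl by (simp add: reflexive_def)
    show "(1 / \<kappa>) *\<^sub>R g \<in> dual_polytope ?Q"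
      using leQ \<open>\<kappa> > 0\<close> by (auto simp: dual_polytope_eq)
    fix u assume u: "\<forall>y\<in>?Q. ((1 / \<kappa>) *\<^sub>R g) \<bullet> y = 1 \<longrightarrow> u \<bullet> y = 1"
    have tight: "u \<bullet> (real_of_int \<delta> *\<^sub>R z - a) = 1" if "z \<in> D" "g \<bullet> z = \<beta>" for z
    proof -
      have "real_of_int \<delta> *\<^sub>R z - a \<in> ?Q" using that by (intro imageI hull_inc)
      moreover have "((1 / \<kappa>) *\<^sub>R g) \<bullet> (real_of_int \<delta> *\<^sub>R z - a) = 1"
        using that \<open>\<kappa> > 0\<close> by (simp add: inner_simps \<kappa>_def flip: diff_divide_distrib)
      ultimately show ?thesis using u by blast
    qed
    then have "u \<bullet> z = (1 + u \<bullet> a) / \<delta>" if "z \<in> D" "g \<bullet> z = \<beta>" for z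
      using tight[OF that] \<open>\<delta> > 0\<close> by (simp add: inner_simps field_simps)
    then obtain l where l: "u = l *\<^sub>R g" using unique by blast
    have "g \<bullet> (real_of_int \<delta> *\<^sub>R z0 - a) = \<kappa>" by (simp add: inner_diff_right z0(2) \<kappa>_def)
    with tight[OF z0] have "l * \<kappa> = 1" by (simp add: l)
    with l \<open>\<kappa> > 0\<close> show "u = (1 / \<kappa>) *\<^sub>R g" by (simp add: field_simps)
  qed
  \<comment> \<open>The coordinate of absolute value 1 isolates \<open>1 / \<kappa>\<close>; the
    absolute value covers the normals \<open>- axis i 1\<close> as well as the \<open>0/1\<close>
    ones.\<close>
  then have "\<bar>(1 / \<kappa>) * g $ j\<bar> \<in> \<int>" by (simp only: lattice_point_def vector_scaleR_component real_scaleR_def Ints_abs)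
  then have "1 / \<kappa> \<in> \<int>" using \<open>\<kappa> > 0\<close> by (simp add: abs_mult \<open>\<bar>g $ j\<bar> = 1\<close>)
  moreover have "g \<bullet> a \<in> \<int>"
    using assms(3,4) by (auto simp: inner_vec_def lattice_point_def intro!: Ints_sum Ints_mult)
  then have "\<kappa> \<in> \<int>" using \<open>\<beta> \<in> \<int>\<close> by (auto simp: \<kappa>_def intro!: Ints_diff Ints_mult)
  ultimately obtain k m :: int where km: "1 / \<kappa> = k" "\<kappa> = m" by (auto elim!: Ints_cases)
  then have "real_of_int (k * m) = 1" using \<open>\<kappa> > 0\<close> by (simp add: field_simps)
  then have "k * m = 1" by linarith
  with km \<open>\<kappa> > 0\<close> have "m = 1" by (auto simp: zmult_eq_1_iff)
  with km show ?thesis by (simp add: \<kappa>_def)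
qed

subsection \<open>Cubes\<close>

definition cube_vertices :: "(real ^ 'n::finite) set" where
  "cube_vertices = {v. \<forall>i. v $ i = 0 \<or> v $ i = 1}"

lemma finite_cube_vertices: "finite (cube_vertices :: (real ^ 'n::finite) set)"
proof -
  have "(cube_vertices :: (real ^ 'n) set) \<subseteq> (\<lambda>f. \<chi> i. f i) ` (UNIV \<rightarrow>\<^sub>E {0, 1 :: real})"
  proof
    fix v :: "real ^ 'n" assume "v \<in> cube_vertices"
    then show "v \<in> (\<lambda>f. \<chi> i. f i) ` (UNIV \<rightarrow>\<^sub>E {0, 1})"
      by (intro image_eqI[of _ _ "($) v"]) (auto simp: cube_vertices_def)
  qed
  then show ?thesis by (rule finite_subset) (intro finite_imageI finite_PiE, auto)
qed

lemma unit_cube_affinity: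
  "(\<lambda>v. a + 2 *\<^sub>R v) ` (cbox 0 1) = (cbox a (a + 2) :: (real ^ 'n) set)"
proof -
  have "a + 2 *\<^sub>R 1 = a + (2 :: real ^ 'n)" by (simp add: vec_eq_iff)
  moreover have "cbox 0 (1 :: real ^ 'n) \<noteq> {}" by (simp add: interval_ne_empty_cart)
  ultimately show ?thesis
    using image_affinity_cbox[of 2 a "0 :: real ^ 'n" 1] by (simp add: add.commute)
qed

lemma cube_eq_convex_hull:
  "(cbox a (a + 2) :: (real ^ 'n) set) = convex hull ((\<lambda>v. a + 2 *\<^sub>R v) ` cube_vertices)"
proof -
  \<comment> \<open>\<open>unit_interval_convex_hull\<close> has the sum of the basis vectors as its
    upper corner, which is the all-ones vector here.\<close>
  have "(\<Sum>Basis :: real ^ 'n) $ i = 1" for i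
  proof -
    have "axis i 1 \<in> (Basis :: (real ^ 'n) set)" by (auto simp: Basis_vec_def)
    then have "(\<Sum>Basis :: real ^ 'n) \<bullet> axis i 1 = 1"
      by (simp add: inner_sum_left inner_Basis sum.If_cases)
    then show ?thesis by (simp add: inner_axis)
  qed
  then have "(\<Sum>Basis :: real ^ 'n) = 1" by (simp add: vec_eq_iff)
  then have "cbox 0 1 = convex hull (cube_vertices :: (real ^ 'n) set)"
    using unit_interval_convex_hull[where 'a = "real ^ 'n"]
    by (simp add: cube_vertices_def Basis_vec_def inner_axis)
  then show ?thesis
    by (simp add: convex_hull_affinity flip: unit_cube_affinity)
qed

lemma lattice_polytope_cube:
  assumes "lattice_point a"
  shows "lattice_polytope (cbox a (a + 2) :: (real ^ 'n) set)"
  unfolding cube_eq_convex_hull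
proof (rule lattice_polytope_convex_hull)
  fix v assume "v \<in> (\<lambda>v. a + 2 *\<^sub>R v) ` (cube_vertices :: (real ^ 'n) set)"
  then obtain w where w: "v = a + 2 *\<^sub>R w" "\<forall>i. w $ i = 0 \<or> w $ i = 1"
    by (auto simp: cube_vertices_def)
  have "v $ i \<in> \<int>" for i
    using assms w(2)[rule_format, of i] by (auto simp: w(1) lattice_point_def)
  then show "lattice_point v" by (simp add: lattice_point_def)
qed (intro finite_imageI finite_cube_vertices)

text \<open>The dual of the cube is the cross-polytope. Listing the origin among the generators
  accounts for zero coordinates of \<open>u\<close> and for points of 1-norm below 1.\<close>

lemma dual_cube:
  "dual_polytope (cbox (- 1) 1 :: (real ^ 'n) set) =
    convex hull (insert 0 (range (\<lambda>i. axis i 1) \<union> range (\<lambda>i. - axis i 1)))" (is "_ = convex hull ?S")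
proof
  have "v \<in> dual_polytope (cbox (- 1) 1)" if "v \<in> ?S" for v :: "real ^ 'n"
  proof -
    have "- (y $ i) \<le> 1 \<and> y $ i \<le> 1" if "y \<in> cbox (- 1) 1" for y :: "real ^ 'n" and i
      using that by (simp add: mem_box_cart minus_le_iff[of "y $ i"])
    with that show ?thesis by (auto simp: dual_polytope_eq inner_axis')
  qed
  then show "convex hull ?S \<subseteq> dual_polytope (cbox (- 1) 1)"
    by (intro hull_minimal convex_dual_polytope subsetI)
  show "dual_polytope (cbox (- 1) 1) \<subseteq> convex hull ?S"
  proof
    fix u :: "real ^ 'n" assume u: "u \<in> dual_polytope (cbox (- 1) 1)"
    define t where "t = (\<Sum>i\<in>UNIV. \<bar>u $ i\<bar>)"
    \<comment> \<open>Pairing \<open>u\<close> with its sign vector, a point of the cube, bounds the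
      1-norm of \<open>u\<close> by 1.\<close>
    have "(\<chi> i. sgn (u $ i)) \<in> (cbox (- 1) 1 :: (real ^ 'n) set)"
      by (auto simp: mem_box_cart sgn_if)
    with u have "u \<bullet> (\<chi> i. sgn (u $ i)) \<le> 1" by (auto simp: dual_polytope_eq)
    then have t1: "t \<le> 1" by (simp add: t_def inner_vec_def abs_sgn)
    have "t \<ge> 0" by (simp add: t_def sum_nonneg)
    have u_eq: "u = (\<Sum>i\<in>UNIV. \<bar>u $ i\<bar> *\<^sub>R axis i (sgn (u $ i)))"
      by (simp add: vec_eq_iff axis_def if_distrib[of "\<lambda>x. _ * x"] abs_mult_sgn mult.commute cong: if_cong)
    show "u \<in> convex hull ?S"
    proof (cases "t = 0")
      case True
      then have "u = 0" by (simp add: t_def sum_nonneg_eq_0_iff vec_eq_iff)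
      then show ?thesis by (simp add: hull_inc)
    next
      case False
      \<comment> \<open>\<open>u\<close> rescaled to 1-norm 1, hence a convex combination of signed
        unit vectors and possibly 0; \<open>u\<close> itself lies on the segment from 0 to
        \<open>w\<close>.\<close>
      define w where "w = (\<Sum>i\<in>UNIV. (\<bar>u $ i\<bar> / t) *\<^sub>R axis i (sgn (u $ i)))"
      have "w \<in> convex hull ?S" unfolding w_def
      proof (rule convex_sum)
        show "(\<Sum>i\<in>UNIV. \<bar>u $ i\<bar> / t) = 1"
          using False by (simp add: t_def flip: sum_divide_distrib)
        fix i
        have "axis i (sgn (u $ i)) = - axis i 1 \<or> axis i (sgn (u $ i)) = axis i 1 \<or> axis i (sgn (u $ i)) = 0"
          by (auto simp: sgn_if vec_eq_iff axis_def)
        then show "axis i (sgn (u $ i)) \<in> convex hull ?S" by (intro hull_inc) auto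
      qed (use \<open>t \<ge> 0\<close> in auto)
      then have "(1 - t) *\<^sub>R 0 + t *\<^sub>R w \<in> convex hull ?S"
        using \<open>t \<ge> 0\<close> t1 by (intro convexD[OF convex_convex_hull]) (auto intro: hull_inc)
      also have "(1 - t) *\<^sub>R 0 + t *\<^sub>R w = u"
        using False by (simp add: w_def scaleR_sum_right flip: u_eq)
      finally show ?thesis .
    qed
  qed
qed

lemma reflexive_cube: "reflexive (cbox (- 1) 1 :: (real ^ 'n) set)"
  unfolding reflexive_def
proof (intro conjI)
  have 2: "(1 :: real ^ 'n) = - 1 + 2" by (simp add: vec_eq_iff)
  show "lattice_polytope (cbox (- 1) 1 :: (real ^ 'n) set)"
    by (subst 2, rule lattice_polytope_cube) (simp add: lattice_point_def)
  show int: "0 \<in> interior (cbox (- 1) 1 :: (real ^ 'n) set)" by (simp add: mem_box_cart)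
  then show "aff_dim (cbox (- 1) 1 :: (real ^ 'n) set) = int CARD('n)"
    by (subst aff_dim_nonempty_interior) auto
  show "lattice_polytope (dual_polytope (cbox (- 1) 1 :: (real ^ 'n) set))"
    unfolding dual_cube
    by (rule lattice_polytope_convex_hull) (auto simp: lattice_point_def axis_def)
qed

lemma gorenstein_cube: "gorenstein (cbox 0 2 :: (real ^ 'n) set)"
  unfolding gorenstein_def
proof (intro conjI exI[of _ 1] exI[of _ 1])
  show "lattice_polytope (cbox 0 2 :: (real ^ 'n) set)"
    using lattice_polytope_cube[of "0 :: real ^ 'n"] by (simp add: lattice_point_def)
  have "1 \<in> interior (cbox 0 2 :: (real ^ 'n) set)" by (simp add: mem_box_cart)
  then show "aff_dim (cbox 0 2 :: (real ^ 'n) set) = int CARD('n)"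
    by (subst aff_dim_nonempty_interior) auto
  have "(\<lambda>v. real_of_int 1 *\<^sub>R v - 1) ` cbox 0 2 = (cbox (- 1) 1 :: (real ^ 'n) set)"
    using cbox_translation[of "- 1" 0 "2 :: real ^ 'n"] by simp
  then show "reflexive ((\<lambda>v. real_of_int 1 *\<^sub>R v - 1) ` (cbox 0 2 :: (real ^ 'n) set))"
    using reflexive_cube by simp
qed (auto simp: lattice_point_def)

lemma centred_cube_translation: "(\<lambda>v. v + 1) ` centred_cube = (cbox 0 2 :: (real ^ 'n) set)"
  using unit_cube_affinity[of "0 :: real ^ 'n"]
  by (simp add: centred_cube_def unit_cube_def image_image)

subsection \<open>Facets of down-closed polytopes\<close>

lemma down_setI: "f \<in> X \<Longrightarrow> (\<And>i. a i \<le> f i) \<Longrightarrow> (\<chi> i. real (a i)) \<in> down_set X"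
  by (auto simp: down_set_def)

text \<open>On the face \<open>x_i = 0\<close> lie the origin and all \<open>axis j 1\<close> with
  \<open>j \<noteq> i\<close>, and these determine the normal up to a factor. The assumption
  \<open>cover\<close> is what puts the unit vectors into the polytope. With right hand side 0, the
  facet condition reads \<open>a $ i = 1\<close>.\<close>

lemma gorenstein_translation:
  fixes X :: "('n::finite \<Rightarrow> nat) set" and \<delta> :: int
  assumes refl: "reflexive ((\<lambda>v. real_of_int \<delta> *\<^sub>R v - a) ` (convex hull (down_set X)))"
    and "\<delta> > 0" "lattice_point a" and cover: "\<And>j. \<exists>f\<in>X. f j \<ge> 1"
  shows "a = 1"
proof -
  have zero: "(0 :: real ^ 'n) \<in> down_set X"
  proof -
    obtain f where "f \<in> X" using cover by blast
    from down_setI[OF this, of "\<lambda>_. 0"] show ?thesis by (simp add: zero_vec_def)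
  qed
  have unit: "axis j 1 \<in> down_set X" for j
  proof -
    obtain f where f: "f \<in> X" "f j \<ge> 1" using cover by blast
    then have "(\<chi> i. real (of_bool (i = j))) \<in> down_set X" by (intro down_setI) auto
    then show ?thesis by (simp add: axis_def of_bool_def if_distrib cong: if_cong)
  qed
  have "real_of_int \<delta> * 0 - (- axis i 1) \<bullet> a = 1" for i
  proof (rule gorenstein_facet[OF refl \<open>\<delta> > 0\<close> \<open>lattice_point a\<close>, where j = i and ?z0.0 = 0])
    fix z assume "z \<in> down_set X"
    then show "- axis i 1 \<bullet> z \<le> 0" by (auto simp: down_set_def inner_axis')
  next
    fix u \<gamma> assume u: "\<forall>z\<in>down_set X. - axis i 1 \<bullet> z = 0 \<longrightarrow> u \<bullet> z = \<gamma>"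
    then have "\<gamma> = 0" using zero by auto
    have "u $ j = 0" if "j \<noteq> i" for j
    proof -
      have "u \<bullet> axis j 1 = \<gamma>" using u unit[of j] that by (auto simp: inner_axis_axis)
      with \<open>\<gamma> = 0\<close> show ?thesis by (simp add: inner_axis)
    qed
    then have "u = (- u $ i) *\<^sub>R - axis i 1" by (simp add: vec_eq_iff axis_def)
    then show "\<exists>l. u = l *\<^sub>R - axis i 1" ..
  qed (use zero in \<open>auto simp: lattice_point_def axis_def\<close>)
  then show ?thesis by (simp add: vec_eq_iff inner_axis')
qed

lemma sum_exchange:
  fixes f f' :: "'n::finite \<Rightarrow> nat"
  assumes "k \<in> A" "j \<in> A" "k \<noteq> j" "f' k = f k + 1" "f j = f' j + 1"
    and "\<And>i. i \<noteq> k \<Longrightarrow> i \<noteq> j \<Longrightarrow> f' i = f i"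
  shows "(\<Sum>i\<in>A. f' i) = (\<Sum>i\<in>A. f i)"
proof -
  have split: "(\<Sum>i\<in>A. g i) = g k + g j + (\<Sum>i\<in>A - {k, j}. g i)" for g :: "'n \<Rightarrow> nat"
  proof -
    have "A = insert k (insert j (A - {k, j}))" using assms by auto
    then show ?thesis using \<open>k \<noteq> j\<close>
      by (metis (no_types, lifting) Diff_iff add.assoc finite finite_Diff insert_iff sum.insert)
  qed
  have "(\<Sum>i\<in>A - {k, j}. f' i) = (\<Sum>i\<in>A - {k, j}. f i)"
    using assms(6) by (intro sum.cong) auto
  then show ?thesis using assms by (simp add: split[of f] split[of f'])
qed

text \<open>For \<open>k\<close> outside \<open>A\<close>, lowering coordinate \<open>k\<close> of a
  tight point leaves it tight, so \<open>u $ k = 0\<close>. For \<open>k\<close> in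
  \<open>A\<close>, two tight points that differ by a unit moved between \<open>j\<close> and
  \<open>k\<close> give \<open>u $ k = u $ j\<close>. Hence the normal is determined, and
  \<open>gorenstein_facet\<close> with translation vector 1 subtracts \<open>card A\<close>.\<close>

lemma gorenstein_indicator:
  fixes X :: "('n::finite \<Rightarrow> nat) set" and \<delta> :: int
  assumes refl: "reflexive ((\<lambda>v. real_of_int \<delta> *\<^sub>R v - 1) ` (convex hull (down_set X)))"
    and "\<delta> > 0"
    and bound: "\<And>f. f \<in> X \<Longrightarrow> (\<Sum>i\<in>A. f i) \<le> b"
    and tight: "f0 \<in> X" "(\<Sum>i\<in>A. f0 i) = b"
    and "j \<in> A"
    and outside: "\<And>k. k \<notin> A \<Longrightarrow> \<exists>f\<in>X. (\<Sum>i\<in>A. f i) = b \<and> f k \<ge> 1"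
    and inside: "\<And>k. k \<in> A \<Longrightarrow> k \<noteq> j \<Longrightarrow> \<exists>f\<in>X. \<exists>f'\<in>X. (\<Sum>i\<in>A. f' i) = b \<and>
        f' k = f k + 1 \<and> f j = f' j + 1 \<and> (\<forall>i. i \<noteq> k \<longrightarrow> i \<noteq> j \<longrightarrow> f' i = f i)"
  shows "\<delta> * int b = int (card A) + 1"
proof -
  define g :: "real ^ 'n" where "g = (\<chi> i. of_bool (i \<in> A))"
  have g: "g \<bullet> (\<chi> i. real (f i)) = real (\<Sum>i\<in>A. f i)" for f
    by (simp add: g_def inner_vec_def of_bool_def if_distrib[of "\<lambda>x. x * _"] sum.If_cases
        cong: if_cong)
  have "real_of_int \<delta> * real b - g \<bullet> 1 = 1"
  proof (rule gorenstein_facet[OF refl \<open>\<delta> > 0\<close>, where j = j and ?z0.0 = "\<chi> i. real (f0 i)"])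
    show "lattice_point g" by (simp add: g_def lattice_point_def)
    show "\<bar>g $ j\<bar> = 1" using \<open>j \<in> A\<close> by (simp add: g_def)
    show "(\<chi> i. real (f0 i)) \<in> down_set X" using tight by (intro down_setI) auto
    show "g \<bullet> (\<chi> i. real (f0 i)) = real b" by (simp only: g tight)
  next
    fix z assume "z \<in> down_set X"
    then obtain a f where z: "z = (\<chi> i. real (a i))" "f \<in> X" "\<And>i. a i \<le> f i"
      by (auto simp: down_set_def)
    have "(\<Sum>i\<in>A. a i) \<le> b" using bound[OF z(2)] sum_mono[of A a f] z(3) by fastforce
    then show "g \<bullet> z \<le> real b" unfolding z g by linarith
  next
    fix u \<gamma> assume u: "\<forall>z\<in>down_set X. g \<bullet> z = real b \<longrightarrow> u \<bullet> z = \<gamma>"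
    have u': "u \<bullet> (\<chi> i. real (a i)) = \<gamma>" if "f \<in> X" "\<And>i. a i \<le> f i" "(\<Sum>i\<in>A. a i) = b" for f a
      using u down_setI[of f X a] that g by auto
    have out: "u $ k = 0" if k: "k \<notin> A" for k
    proof -
      obtain f where f: "f \<in> X" "(\<Sum>i\<in>A. f i) = b" "f k \<ge> 1" using outside[OF k] by blast
      have "(\<Sum>i\<in>A. (f(k := f k - 1)) i) = b"
        using that f(2) by (metis (no_types, lifting) fun_upd_other sum.cong)
      then have "u \<bullet> (\<chi> i. real ((f(k := f k - 1)) i)) = u \<bullet> (\<chi> i. real (f i))"
        using u'[OF f(1), of f] u'[OF f(1), of "f(k := f k - 1)"] f by auto
      moreover have "(\<chi> i. real ((f(k := f k - 1)) i)) = (\<chi> i. real (f i)) - axis k 1"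
        using f(3) by (auto simp: vec_eq_iff axis_def)
      ultimately show ?thesis by (simp add: inner_diff_right inner_axis)
    qed
    have "u $ k = u $ j" if k: "k \<in> A" for k
    proof (cases "k = j")
      case False
      obtain f f' where f: "f \<in> X" "f' \<in> X" "(\<Sum>i\<in>A. f' i) = b"
          "f' k = f k + 1" "f j = f' j + 1" "\<forall>i. i \<noteq> k \<longrightarrow> i \<noteq> j \<longrightarrow> f' i = f i"
        using inside[OF k False] by blast
      \<comment> \<open>Tightness is given for \<open>f'\<close> only; moving a unit inside
        \<open>A\<close> transfers it to \<open>f\<close>.\<close>
      have "(\<Sum>i\<in>A. f i) = b"
        using sum_exchange[OF that \<open>j \<in> A\<close> False f(4,5)] f(3,6) by auto
      then have "u \<bullet> (\<chi> i. real (f' i)) = u \<bullet> (\<chi> i. real (f i))"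
        using u'[OF f(1), of f] u'[OF f(2), of f'] f(3) by auto
      moreover have "(\<chi> i. real (f' i)) = (\<chi> i. real (f i)) + axis k 1 - axis j 1"
        using f False by (auto simp: vec_eq_iff axis_def)
      ultimately show ?thesis by (simp add: inner_diff_right inner_add_right inner_axis)
    qed simp
    with out have "u = (u $ j) *\<^sub>R g" by (simp add: vec_eq_iff g_def)
    then show "\<exists>l. u = l *\<^sub>R g" ..
  qed (auto simp: lattice_point_def)
  moreover have "g \<bullet> 1 = real (card A)" using g[of "\<lambda>_. 1"] by (simp add: one_vec_def)
  ultimately have "real_of_int (\<delta> * int b) = real_of_int (int (card A) + 1)" by simp
  then show ?thesis by linarith
qed

lemma convex_hull_down_set_cube:
  fixes X :: "('n::finite \<Rightarrow> nat) set"
  assumes "\<And>f i. f \<in> X \<Longrightarrow> f i \<le> 2" "(\<lambda>_. 2) \<in> X"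
  shows "convex hull (down_set X) = cbox 0 2"
proof
  have "down_set X \<subseteq> cbox 0 2"
    using assms(1) by (fastforce simp: down_set_def mem_box_cart intro: order_trans)
  then show "convex hull (down_set X) \<subseteq> cbox 0 2" by (intro hull_minimal convex_box)
  have "(\<lambda>v. 0 + 2 *\<^sub>R v) ` cube_vertices \<subseteq> down_set X"
  proof clarify
    fix v :: "real ^ 'n" assume "v \<in> cube_vertices"
    then have "0 + 2 *\<^sub>R v = (\<chi> i. real (if v $ i = 0 then 0 else 2))"
      by (auto simp: vec_eq_iff cube_vertices_def)
    moreover have "\<dots> \<in> down_set X" using assms(2) by (intro down_setI) auto
    ultimately show "0 + 2 *\<^sub>R v \<in> down_set X" by simp
  qed
  then have "convex hull ((\<lambda>v. 0 + 2 *\<^sub>R v) ` cube_vertices) \<subseteq> convex hull (down_set X)"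
    by (rule hull_mono)
  then show "cbox 0 2 \<subseteq> convex hull (down_set X)"
    unfolding cube_eq_convex_hull[symmetric] by simp
qed

subsection \<open>Exchange arguments for maximum matchings with multiplicities\<close>

lemma deg_pos_iff: "deg M i \<ge> 1 \<longleftrightarrow> (\<exists>e\<in>#M. i \<in> e)"
proof -
  have "deg M i \<ge> 1 \<longleftrightarrow> filter_mset (\<lambda>e. i \<in> e) M \<noteq> {#}"
    unfolding deg_def by (simp add: Suc_le_eq size_eq_0_iff_empty flip: neq0_conv)
  then show ?thesis by (auto simp: filter_mset_eq_conv)
qed

lemma deg_remove:
  assumes "e \<in># M"
  shows "deg M i = of_bool (i \<in> e) + deg (M - {#e#}) i"
  using assms deg_simps(3)[of e "M - {#e#}" i] by simp

lemma deg_exchange: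
  assumes "e \<in># M"
  shows "deg (add_mset f (M - {#e#})) i + of_bool (i \<in> e) = deg M i + of_bool (i \<in> f)"
  by (simp add: deg_remove[OF assms])

lemma max_bmatching_exists:
  fixes E :: "'n::finite set set"
  assumes "loopless E"
  shows "\<exists>M. max_bmatching E c M"
proof -
  have "bmatching E c {#}" by (simp add: bmatching_def)
  moreover have "\<forall>M. bmatching E c M \<longrightarrow> size M < Suc (\<Sum>i\<in>UNIV. c $ i)"
    using bmatching_size_le[OF assms, of c] by fastforce
  ultimately show ?thesis
    unfolding max_bmatching_def by (rule ex_has_greatest_nat)
qed

lemma max_bmatching_deg_le: "max_bmatching E c M \<Longrightarrow> deg M i \<le> c $ i"
  by (simp add: max_bmatching_def bmatching_def)

lemma max_bmatching_edge: "max_bmatching E c M \<Longrightarrow> e \<in># M \<Longrightarrow> e \<in> E"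
  by (auto simp: max_bmatching_def bmatching_def)

lemma max_bmatching_same_size:
  assumes "max_bmatching E c M" "bmatching E c N" "size N = size M"
  shows "max_bmatching E c N"
  using assms by (simp add: max_bmatching_def)

text \<open>Otherwise the edge \<open>{i, j}\<close> could be added to \<open>M\<close>.\<close>

lemma max_bmatching_saturated:
  assumes "max_bmatching E c M" "{i, j} \<in> E" "deg M i < c $ i"
  shows "deg M j = c $ j"
proof (rule ccontr)
  assume "deg M j \<noteq> c $ j"
  then have "deg M j < c $ j" using max_bmatching_deg_le[OF assms(1), of j] by simp
  with assms have "bmatching E c (add_mset {i, j} M)"
    by (auto simp: max_bmatching_def bmatching_def)
  with assms(1) have "size (add_mset {i, j} M) \<le> size M" unfolding max_bmatching_def by blast
  then show False by simp
qed

text \<open>Removing \<open>e\<close> frees a unit at each common end, so only the ends of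
  \<open>f\<close> outside \<open>e\<close> need spare capacity.\<close>

lemma max_bmatching_exchange:
  assumes "max_bmatching E c M" "e \<in># M" "f \<in> E"
    and "\<And>i. i \<in> f \<Longrightarrow> i \<notin> e \<Longrightarrow> deg M i < c $ i"
  shows "max_bmatching E c (add_mset f (M - {#e#}))"
proof (rule max_bmatching_same_size[OF assms(1)])
  show "bmatching E c (add_mset f (M - {#e#}))"
    unfolding bmatching_def
  proof (intro conjI allI)
    show "set_mset (add_mset f (M - {#e#})) \<subseteq> E"
      using assms by (auto simp: max_bmatching_def bmatching_def dest: in_diffD)
    fix i
    show "deg (add_mset f (M - {#e#})) i \<le> c $ i"
      using deg_exchange[OF assms(2), of f i] assms(4)[of i] max_bmatching_deg_le[OF assms(1), of i]
      by (auto split: if_splits simp: of_bool_def)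
  qed
  show "size (add_mset f (M - {#e#})) = size M"
    using assms(2) by (metis insert_DiffM size_add_mset)
qed

lemma loopless_edgeD: "loopless E \<Longrightarrow> {i, j} \<in> E \<Longrightarrow> i \<noteq> j"
  by (force simp: loopless_def)

lemma loopless_edgeE:
  assumes "loopless E" "e \<in> E" "i \<in> e"
  obtains j where "e = {i, j}" "i \<noteq> j"
proof -
  have "card e = 2" using assms by (simp add: loopless_def)
  then obtain a b where "e = {a, b}" "a \<noteq> b" by (auto simp: card_2_iff)
  with assms(3) that show ?thesis by (cases "i = a") auto
qed

text \<open>If \<open>M\<close> misses \<open>k\<close>, its neighbour \<open>l\<close> is
  saturated, and an edge of \<open>M\<close> at \<open>l\<close> can be traded for
  \<open>{k, l}\<close>.\<close>

lemma max_bmatching_cover_vertex: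
  fixes E :: "'n::finite set set"
  assumes "loopless E" "\<And>i. c $ i > 0" "{k, l} \<in> E"
  shows "\<exists>M. max_bmatching E c M \<and> deg M k \<ge> 1"
proof -
  obtain M where M: "max_bmatching E c M" using max_bmatching_exists[OF assms(1)] by blast
  show ?thesis
  proof (cases "deg M k \<ge> 1")
    case False
    then have k: "deg M k < c $ k" using assms(2)[of k] by simp
    then have "deg M l = c $ l" using max_bmatching_saturated[OF M assms(3)] by simp
    with assms(2)[of l] have "deg M l \<ge> 1" by linarith
    then obtain e where e: "e \<in># M" "l \<in> e" by (meson deg_pos_iff)
    have "max_bmatching E c (add_mset {k, l} (M - {#e#}))"
      using k e by (intro max_bmatching_exchange[OF M _ assms(3)]) auto
    then show ?thesis by (intro exI conjI) auto
  qed (use M in blast)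
qed

text \<open>The exchange must now preserve the degree of \<open>j\<close>. If \<open>j\<close> and
  \<open>k\<close> are adjacent, an edge at \<open>j\<close> is traded for \<open>{j, k}\<close>.
  Otherwise an edge at \<open>l\<close> is traded for \<open>{k, l}\<close>, and that edge avoids
  \<open>j\<close> because \<open>l\<close> is not a neighbour of \<open>j\<close>.\<close>

lemma max_bmatching_cover_second:
  fixes E :: "'n::finite set set"
  assumes E: "loopless E" and M: "max_bmatching E c M" and "\<And>i. c $ i > 0"
    and "deg M j \<ge> 1" "k \<noteq> j"
    and nbr: "{j, k} \<in> E \<or> (\<exists>l. {k, l} \<in> E \<and> {j, l} \<notin> E)"
  shows "\<exists>M'. max_bmatching E c M' \<and> deg M' j = deg M j \<and> deg M' k \<ge> 1"
proof (cases "deg M k \<ge> 1")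
  case False
  then have k: "deg M k < c $ k" using assms(3)[of k] by simp
  show ?thesis
  proof (cases "{j, k} \<in> E")
    case True
    obtain e where e: "e \<in># M" "j \<in> e" using \<open>deg M j \<ge> 1\<close> by (meson deg_pos_iff)
    have "max_bmatching E c (add_mset {j, k} (M - {#e#}))"
      using k e by (intro max_bmatching_exchange[OF M _ True]) auto
    moreover have "deg (add_mset {j, k} (M - {#e#})) j = deg M j"
      using deg_exchange[OF e(1), of "{j, k}" j] e(2) by simp
    moreover have "deg (add_mset {j, k} (M - {#e#})) k \<ge> 1" by simp
    ultimately show ?thesis by blast
  next
    case False
    with nbr obtain l where l: "{k, l} \<in> E" "{j, l} \<notin> E" by blast
    with False have "l \<noteq> j" by (auto simp: insert_commute)
    have "deg M l = c $ l" using max_bmatching_saturated[OF M l(1) k] .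
    with assms(3)[of l] have "deg M l \<ge> 1" by linarith
    then obtain e where e: "e \<in># M" "l \<in> e" by (meson deg_pos_iff)
    have "j \<notin> e"
    proof
      assume "j \<in> e"
      then obtain m where "e = {j, m}" using loopless_edgeE[OF E max_bmatching_edge[OF M e(1)]] by blast
      with e(2) \<open>l \<noteq> j\<close> have "e = {j, l}" by auto
      with l(2) max_bmatching_edge[OF M e(1)] show False by simp
    qed
    have "max_bmatching E c (add_mset {k, l} (M - {#e#}))"
      using k e by (intro max_bmatching_exchange[OF M _ l(1)]) auto
    moreover have "deg (add_mset {k, l} (M - {#e#})) j = deg M j"
      using deg_exchange[OF e(1), of "{k, l}" j] \<open>j \<notin> e\<close> \<open>l \<noteq> j\<close> \<open>k \<noteq> j\<close> by simp
    moreover have "deg (add_mset {k, l} (M - {#e#})) k \<ge> 1" by simp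
    ultimately show ?thesis by blast
  qed
qed (use M in blast)

lemma sum_deg_le:
  fixes A B :: "'n::finite set"
  assumes "\<And>e. e \<in># M \<Longrightarrow> card (e \<inter> A) \<le> card (e \<inter> B)"
  shows "(\<Sum>i\<in>A. deg M i) \<le> (\<Sum>i\<in>B. deg M i)"
  unfolding sum_deg[OF finite] using assms by (rule sum_mset_mono)

text \<open>An edge that meets \<open>A\<close> has its other end in \<open>B - A\<close>, so it
  counts once for \<open>A\<close> and at least once for \<open>B\<close>. Combined with
  \<open>sum_deg_le\<close> this bounds degree sums over independent sets by those over their
  neighbours.\<close>

lemma card_Int_le_neighbour:
  fixes A B :: "'n::finite set"
  assumes E: "loopless E" "e \<in> E"
    and nbr: "\<And>i k. i \<in> A \<Longrightarrow> e = {i, k} \<Longrightarrow> k \<in> B - A"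
  shows "card (e \<inter> A) \<le> card (e \<inter> B)"
proof (cases "e \<inter> A = {}")
  case False
  then obtain i where i: "i \<in> e" "i \<in> A" by blast
  then obtain k where k: "e = {i, k}" "i \<noteq> k" using loopless_edgeE[OF E] by blast
  with nbr[OF i(2)] have "e \<inter> A = {i}" "k \<in> e \<inter> B" using i by auto
  then show ?thesis by (metis One_nat_def Suc_leI card_gt_0_iff empty_iff finite is_singletonI is_singleton_altdef)
qed simp

section \<open>Largest degrees and facets given by single vertices\<close>

definition matching_polytope :: "'n::finite set set \<Rightarrow> nat ^ 'n \<Rightarrow> (real ^ 'n) set" where
  "matching_polytope E c = convex hull (down_set (deg ` {M. max_bmatching E c M}))"

lemma max_deg_obtain:
  fixes E :: "'n::finite set set"
  assumes "loopless E" "\<And>i. c $ i > 0" "{k, l} \<in> E"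
  obtains m M where "max_bmatching E c M" "deg M k = m" "m \<ge> 1"
    "\<And>N. max_bmatching E c N \<Longrightarrow> deg N k \<le> m"
proof -
  obtain M0 where M0: "max_bmatching E c M0" "deg M0 k \<ge> 1"
    using max_bmatching_cover_vertex[OF assms(1), of c k l, OF assms(2,3)] by blast
  have "\<exists>M. max_bmatching E c M \<and> (\<forall>N. max_bmatching E c N \<longrightarrow> deg N k \<le> deg M k)"
    using M0(1) by (rule ex_has_greatest_nat[where b = "Suc (c $ k)"])
      (auto simp: less_Suc_eq_le max_bmatching_deg_le)
  then obtain M where "max_bmatching E c M" "\<And>N. max_bmatching E c N \<Longrightarrow> deg N k \<le> deg M k"
    by blast
  then show ?thesis using that M0 le_trans by blast
qed

lemma gorenstein_vertex:
  fixes E :: "'n::finite set set" and \<delta> :: int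
  assumes refl: "reflexive ((\<lambda>v. real_of_int \<delta> *\<^sub>R v - 1) ` matching_polytope E c)" and "\<delta> > 0"
    and M: "max_bmatching E c M" "deg M j = m"
    and bound: "\<And>N. max_bmatching E c N \<Longrightarrow> deg N j \<le> m"
    and cover: "\<And>k. k \<noteq> j \<Longrightarrow> \<exists>N. max_bmatching E c N \<and> deg N j = m \<and> deg N k \<ge> 1"
  shows "\<delta> * int m = 2"
proof -
  have "\<delta> * int m = int (card {j}) + 1"
    using refl unfolding matching_polytope_def
  proof (rule gorenstein_indicator[OF _ \<open>\<delta> > 0\<close>])
    show "deg M \<in> deg ` {M. max_bmatching E c M}" using M by blast
    fix k assume "k \<notin> {j}"
    with cover obtain N where "max_bmatching E c N" "deg N j = m" "deg N k \<ge> 1" by blast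
    then show "\<exists>f\<in>deg ` {M. max_bmatching E c M}. sum f {j} = m \<and> 1 \<le> f k" by auto
  qed (use M bound in auto)
  then show ?thesis by simp
qed

subsection \<open>Pendant edges and pendant triangles\<close>

lemma deg_sum: "finite A \<Longrightarrow> deg (\<Sum>a\<in>A. F a) i = (\<Sum>a\<in>A. deg (F a) i)"
  by (induction A rule: finite_induct) auto

text \<open>\<open>V\<close> holds the vertices with a pendant edge, \<open>P\<close> the base
  vertices of the triangles, whose other corners are \<open>tq p\<close> and \<open>tw p\<close>.
  The neighbour assumptions bound each neighbourhood from above, so that vertex arguments become
  case checks; connectedness of the bipartite graph enters as a neighbour in \<open>V\<close> for
  each base vertex.\<close>

locale pendant_graph =
  fixes V P :: "'n::finite set" and leaf tq tw :: "'n \<Rightarrow> 'n" and E :: "'n set set"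
  assumes loopless: "loopless E"
    and nonempty: "V \<noteq> {}" "P \<noteq> {}"
    and vertices: "UNIV = V \<union> leaf ` V \<union> P \<union> tq ` P \<union> tw ` P"
    and inj: "inj_on leaf V" "inj_on tq P" "inj_on tw P"
    and disjoint: "V \<inter> leaf ` V = {}" "V \<inter> P = {}" "V \<inter> tq ` P = {}" "V \<inter> tw ` P = {}"
      "leaf ` V \<inter> P = {}" "leaf ` V \<inter> tq ` P = {}" "leaf ` V \<inter> tw ` P = {}"
      "P \<inter> tq ` P = {}" "P \<inter> tw ` P = {}" "tq ` P \<inter> tw ` P = {}"
    and pendant_edge: "\<And>v. v \<in> V \<Longrightarrow> {v, leaf v} \<in> E"
    and triangle: "\<And>p. p \<in> P \<Longrightarrow> {p, tq p} \<in> E" "\<And>p. p \<in> P \<Longrightarrow> {p, tw p} \<in> E"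
      "\<And>p. p \<in> P \<Longrightarrow> {tq p, tw p} \<in> E"
    and nbr_V: "\<And>v k. v \<in> V \<Longrightarrow> {v, k} \<in> E \<Longrightarrow> k = leaf v \<or> k \<in> P"
    and nbr_leaf: "\<And>v k. v \<in> V \<Longrightarrow> {leaf v, k} \<in> E \<Longrightarrow> k = v"
    and nbr_P: "\<And>p k. p \<in> P \<Longrightarrow> {p, k} \<in> E \<Longrightarrow> k = tq p \<or> k = tw p \<or> k \<in> V"
    and nbr_tq: "\<And>p k. p \<in> P \<Longrightarrow> {tq p, k} \<in> E \<Longrightarrow> k = p \<or> k = tw p"
    and nbr_tw: "\<And>p k. p \<in> P \<Longrightarrow> {tw p, k} \<in> E \<Longrightarrow> k = p \<or> k = tq p"
    and connected: "\<And>p. p \<in> P \<Longrightarrow> \<exists>v\<in>V. {p, v} \<in> E"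
begin

lemma vertex_cases:
  obtains v where "v \<in> V" "i = v" | v where "v \<in> V" "i = leaf v"
    | p where "p \<in> P" "i = p" | p where "p \<in> P" "i = tq p" | p where "p \<in> P" "i = tw p"
  using vertices by blast

lemma distinct [simp]:
  "v \<in> V \<Longrightarrow> v' \<in> V \<Longrightarrow> v \<noteq> leaf v'" "v \<in> V \<Longrightarrow> v' \<in> V \<Longrightarrow> leaf v' \<noteq> v"
  "v \<in> V \<Longrightarrow> p \<in> P \<Longrightarrow> v \<noteq> p" "v \<in> V \<Longrightarrow> p \<in> P \<Longrightarrow> p \<noteq> v"
  "v \<in> V \<Longrightarrow> p \<in> P \<Longrightarrow> v \<noteq> tq p" "v \<in> V \<Longrightarrow> p \<in> P \<Longrightarrow> tq p \<noteq> v"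
  "v \<in> V \<Longrightarrow> p \<in> P \<Longrightarrow> v \<noteq> tw p" "v \<in> V \<Longrightarrow> p \<in> P \<Longrightarrow> tw p \<noteq> v"
  "v \<in> V \<Longrightarrow> p \<in> P \<Longrightarrow> leaf v \<noteq> p" "v \<in> V \<Longrightarrow> p \<in> P \<Longrightarrow> p \<noteq> leaf v"
  "v \<in> V \<Longrightarrow> p \<in> P \<Longrightarrow> leaf v \<noteq> tq p" "v \<in> V \<Longrightarrow> p \<in> P \<Longrightarrow> tq p \<noteq> leaf v"
  "v \<in> V \<Longrightarrow> p \<in> P \<Longrightarrow> leaf v \<noteq> tw p" "v \<in> V \<Longrightarrow> p \<in> P \<Longrightarrow> tw p \<noteq> leaf v"
  "p \<in> P \<Longrightarrow> p' \<in> P \<Longrightarrow> p \<noteq> tq p'" "p \<in> P \<Longrightarrow> p' \<in> P \<Longrightarrow> tq p' \<noteq> p"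
  "p \<in> P \<Longrightarrow> p' \<in> P \<Longrightarrow> p \<noteq> tw p'" "p \<in> P \<Longrightarrow> p' \<in> P \<Longrightarrow> tw p' \<noteq> p"
  "p \<in> P \<Longrightarrow> p' \<in> P \<Longrightarrow> tq p \<noteq> tw p'" "p \<in> P \<Longrightarrow> p' \<in> P \<Longrightarrow> tw p' \<noteq> tq p"
  by (metis disjoint disjoint_iff imageI)+

lemma inj_iffs [simp]:
  "v \<in> V \<Longrightarrow> v' \<in> V \<Longrightarrow> leaf v = leaf v' \<longleftrightarrow> v = v'"
  "p \<in> P \<Longrightarrow> p' \<in> P \<Longrightarrow> tq p = tq p' \<longleftrightarrow> p = p'"
  "p \<in> P \<Longrightarrow> p' \<in> P \<Longrightarrow> tw p = tw p' \<longleftrightarrow> p = p'"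
  using inj by (auto simp: inj_on_eq_iff)

lemma notin [simp]:
  "p \<in> P \<Longrightarrow> p \<notin> V" "v \<in> V \<Longrightarrow> v \<notin> P" "v \<in> V \<Longrightarrow> leaf v \<notin> V" "v \<in> V \<Longrightarrow> leaf v \<notin> P"
  "p \<in> P \<Longrightarrow> tq p \<notin> V" "p \<in> P \<Longrightarrow> tq p \<notin> P" "p \<in> P \<Longrightarrow> tw p \<notin> V" "p \<in> P \<Longrightarrow> tw p \<notin> P"
  using disjoint by auto

lemma has_nbr: "\<exists>l. {i, l} \<in> E"
  by (cases i rule: vertex_cases) (auto intro: pendant_edge triangle simp: insert_commute)

text \<open>This classifies the vertices \<open>k\<close> that
  \<open>max_bmatching_cover_second\<close> cannot reach. If \<open>k\<close> is in
  \<open>V\<close>, its leaf has no neighbour except \<open>k\<close>. If \<open>k\<close> is in a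
  triangle, a corner \<open>tq p\<close> or \<open>tw p\<close> next to it confines \<open>j\<close>
  to the same triangle, where \<open>j\<close> would be adjacent to \<open>k\<close>. Only leaves
  remain.\<close>

lemma dominated_vertex:
  assumes "k \<noteq> j" "{j, k} \<notin> E" and dom: "\<And>l. {k, l} \<in> E \<Longrightarrow> {j, l} \<in> E"
  shows "\<exists>v\<in>V. k = leaf v \<and> j \<in> P \<and> {j, v} \<in> E"
proof (cases k rule: vertex_cases)
  case (1 v)
  then have "{leaf v, j} \<in> E" using dom[of "leaf v"] pendant_edge by (simp add: insert_commute)
  with 1 nbr_leaf assms(1) show ?thesis by blast
next
  case (2 v)
  then have "{v, j} \<in> E" using dom[of v] pendant_edge[of v] by (simp add: insert_commute)
  with 2 nbr_V[of v j] assms(1) show ?thesis by (auto simp: insert_commute)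
next
  case (3 p)
  then have "{tq p, j} \<in> E" using dom[of "tq p"] triangle by (simp add: insert_commute)
  then have "j = tw p" using nbr_tq[of p j] 3 assms(1) by auto
  with assms(2) 3 triangle[of p] show ?thesis by (simp add: insert_commute)
next
  case (4 p)
  then have "{tw p, j} \<in> E" using dom[of "tw p"] triangle by (simp add: insert_commute)
  then have "j = p" using nbr_tw[of p j] 4 assms(1) by auto
  with assms(2) 4 triangle[of p] show ?thesis by (simp add: insert_commute)
next
  case (5 p)
  then have "{tq p, j} \<in> E" using dom[of "tq p"] triangle[of p] by (simp add: insert_commute)
  then have "j = p" using nbr_tq[of p j] 5 assms(1) by auto
  with assms(2) 5 triangle[of p] show ?thesis by (simp add: insert_commute)
qed

lemma cover_or_leaf:
  assumes c: "\<And>i. c $ i > 0" and M: "max_bmatching E c M" "deg M j = m" "m \<ge> 1" and "k \<noteq> j"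
  shows "(\<exists>N. max_bmatching E c N \<and> deg N j = m \<and> deg N k \<ge> 1) \<or>
    (\<exists>v\<in>V. k = leaf v \<and> j \<in> P \<and> {j, v} \<in> E)"
proof (cases "{j, k} \<in> E \<or> (\<exists>l. {k, l} \<in> E \<and> {j, l} \<notin> E)")
  case True
  with max_bmatching_cover_second[OF loopless M(1) c, of j k] M assms(5) show ?thesis by simp
next
  case False
  with assms(5) show ?thesis by (intro disjI2 dominated_vertex) auto
qed

text \<open>If each \<open>k\<close> could be covered while \<open>j\<close> has degree
  \<open>m\<close>, then \<open>gorenstein_vertex\<close> would give
  \<open>\<delta> * m = 2\<close>; a vertex for which this fails must be a leaf as in
  \<open>cover_or_leaf\<close>.\<close>

lemma vertex_dichotomy:
  fixes \<delta> :: int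
  assumes refl: "reflexive ((\<lambda>v. real_of_int \<delta> *\<^sub>R v - 1) ` matching_polytope E c)" and "\<delta> > 0"
    and c: "\<And>i. c $ i > 0"
    and M: "max_bmatching E c M" "deg M j = m" "m \<ge> 1"
    and bound: "\<And>N. max_bmatching E c N \<Longrightarrow> deg N j \<le> m"
    and no: "\<delta> * int m \<noteq> 2"
  obtains v where "v \<in> V" "j \<in> P" "{j, v} \<in> E"
    "\<And>N. max_bmatching E c N \<Longrightarrow> deg N j = m \<Longrightarrow> deg N (leaf v) = 0"
proof -
  obtain k where k: "k \<noteq> j" "\<not> (\<exists>N. max_bmatching E c N \<and> deg N j = m \<and> deg N k \<ge> 1)"
    using gorenstein_vertex[OF refl \<open>\<delta> > 0\<close> M(1,2) bound] no by blast
  with cover_or_leaf[OF c M k(1)] obtain v where "v \<in> V" "k = leaf v" "j \<in> P" "{j, v} \<in> E" by blast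
  with k that show ?thesis by (metis One_nat_def Suc_leI neq0_conv)
qed

text \<open>Any exchange that keeps degree \<open>m\<close> at \<open>p\<close> but covers
  \<open>leaf v\<close> is forbidden. So \<open>v\<close> is saturated, and edges of
  \<open>M\<close> at \<open>v\<close> pass through \<open>p\<close>, or else one could be traded
  for \<open>{v, leaf v}\<close>. If a neighbour \<open>l\<close> of \<open>p\<close> had spare
  capacity, trading \<open>{v, p}\<close> for \<open>{p, l}\<close> would leave \<open>v\<close>
  unsaturated. If an edge \<open>e\<close> at \<open>l\<close> missed \<open>p\<close>, trading
  \<open>e\<close> and \<open>{v, p}\<close> for \<open>{p, l}\<close> and
  \<open>{v, leaf v}\<close> would cover the leaf.\<close>

lemma maximal_triangle_vertex:
  assumes c: "\<And>i. c $ i > 0"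
    and M: "max_bmatching E c M" "deg M p = m"
    and v: "v \<in> V" "p \<in> P" "{p, v} \<in> E"
    and leaf: "\<And>N. max_bmatching E c N \<Longrightarrow> deg N p = m \<Longrightarrow> deg N (leaf v) = 0"
  shows "\<And>l. {p, l} \<in> E \<Longrightarrow> deg M l = c $ l"
    and "\<And>l e. {p, l} \<in> E \<Longrightarrow> e \<in># M \<Longrightarrow> l \<in> e \<Longrightarrow> p \<in> e"
proof -
  have edge: "{v, leaf v} \<in> E" using pendant_edge v by simp
  have ne: "p \<noteq> v" "p \<noteq> leaf v" "leaf v \<noteq> v" using v by auto
  have M0: "deg M (leaf v) = 0" using leaf[OF M] .
  have sat_v: "deg N v = c $ v" if "max_bmatching E c N" "deg N p = m" for N
    using max_bmatching_saturated[OF that(1), of "leaf v" v] leaf[OF that] c[of "leaf v"] edge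
    by (simp add: insert_commute)
  have at_v: "p \<in> e" if e: "e \<in># M" "v \<in> e" for e
  proof (rule ccontr)
    assume "p \<notin> e"
    have N: "max_bmatching E c (add_mset {v, leaf v} (M - {#e#}))"
      using e M0 c by (intro max_bmatching_exchange[OF M(1) _ edge]) auto
    have "deg (add_mset {v, leaf v} (M - {#e#})) p = m"
      using deg_exchange[OF e(1), of "{v, leaf v}" p] \<open>p \<notin> e\<close> ne M(2) by simp
    from leaf[OF N this] show False by simp
  qed
  have "deg M v \<ge> 1" using sat_v[OF M] c[of v] by simp
  then obtain e0 where e0: "e0 \<in># M" "v \<in> e0" by (meson deg_pos_iff)
  then obtain w where "e0 = {v, w}" using loopless_edgeE[OF loopless max_bmatching_edge[OF M(1)]] by blast
  with at_v[OF e0] ne have e0v: "e0 = {v, p}" by auto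
  show sat: "deg M l = c $ l" if l: "{p, l} \<in> E" for l
  proof (cases "l = v")
    case False
    have "l \<noteq> p" using l loopless_edgeD[OF loopless] by blast
    show ?thesis
    proof (rule ccontr)
      assume "deg M l \<noteq> c $ l"
      then have "deg M l < c $ l" using max_bmatching_deg_le[OF M(1), of l] by simp
      then have "max_bmatching E c (add_mset {p, l} (M - {#e0#}))"
        using e0 e0v by (intro max_bmatching_exchange[OF M(1) _ l]) auto
      moreover have "deg (add_mset {p, l} (M - {#e0#})) p = m"
        using deg_exchange[OF e0(1), of "{p, l}" p] e0v M(2) by simp
      ultimately have "deg (add_mset {p, l} (M - {#e0#})) v = c $ v" by (rule sat_v)
      moreover have "deg (add_mset {p, l} (M - {#e0#})) v + 1 = deg M v"
        using deg_exchange[OF e0(1), of "{p, l}" v] e0v False ne by simp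
      ultimately show False using max_bmatching_deg_le[OF M(1), of v] by simp
    qed
  qed (use sat_v[OF M] in simp)
  show "p \<in> e" if l: "{p, l} \<in> E" and e: "e \<in># M" "l \<in> e" for l e
  proof (rule ccontr)
    assume p: "p \<notin> e"
    with at_v e have "v \<notin> e" by blast
    have "e \<noteq> e0" using p e0v by blast
    then have e0': "e0 \<in># M - {#e#}" using e0 by (simp add: in_diff_count)
    let ?N = "add_mset {v, leaf v} (add_mset {p, l} (M - {#e#} - {#e0#}))"
    have deg: "deg ?N i + of_bool (i \<in> e) + of_bool (i \<in> e0) =
        deg M i + of_bool (i \<in> {p, l}) + of_bool (i \<in> {v, leaf v})" for i
      by (simp only: deg_simps deg_remove[OF e(1), of i] deg_remove[OF e0', of i])
    have "l \<noteq> leaf v" using l nbr_P[of p l] v by auto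
    have "l \<noteq> p" using l loopless_edgeD[OF loopless] by blast
    have N: "max_bmatching E c ?N"
    proof (rule max_bmatching_same_size[OF M(1)])
      show "bmatching E c ?N" unfolding bmatching_def
      proof (intro conjI allI)
        show "set_mset ?N \<subseteq> E"
          using l edge M(1) by (auto simp: max_bmatching_def bmatching_def dest!: in_diffD)
        fix i
        \<comment> \<open>The capacity check as Boolean case analysis: \<open>e\<close> stands for
          membership of \<open>i\<close> in the removed edge, and \<open>x\<close>,
          \<open>y\<close>, \<open>z\<close>, \<open>w\<close> for \<open>i\<close> being
          \<open>v\<close>, \<open>p\<close>, \<open>l\<close>, \<open>leaf v\<close>.\<close>
        have arith: "d' \<le> b" if "d' + of_bool e + of_bool (x \<or> y) = d + of_bool (y \<or> z) + of_bool (x \<or> w)"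
          "d \<le> b" "z \<Longrightarrow> e" "w \<Longrightarrow> d = 0 \<and> b > 0 \<and> \<not> y \<and> \<not> z" "\<not> (y \<and> z)" "\<not> (x \<and> z)" "\<not> (x \<and> y)"
          for d' d b :: nat and e x y z w
          using that by (cases e; cases x; cases y; cases z; cases w) auto
        show "deg ?N i \<le> c $ i"
        proof (rule arith)
          show "deg ?N i + of_bool (i \<in> e) + of_bool (i = v \<or> i = p) =
              deg M i + of_bool (i = p \<or> i = l) + of_bool (i = v \<or> i = leaf v)"
            using deg[of i] by (simp only: e0v insert_iff empty_iff simp_thms)
          show "deg M i \<le> c $ i" by (rule max_bmatching_deg_le[OF M(1)])
        qed (use e(2) ne \<open>l \<noteq> leaf v\<close> \<open>l \<noteq> p\<close> \<open>v \<notin> e\<close> M0 c in auto)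
      qed
      show "size ?N = size M" using size_Suc_Diff1[OF e(1)] size_Suc_Diff1[OF e0'] by simp
    qed
    have "deg ?N p = m"
      using deg[of p] p e0v ne M(2) by (simp del: deg_simps)
    from leaf[OF N this] show False by simp
  qed
qed

lemma nbrs_P:
  assumes "p \<in> P"
  shows "{l. {p, l} \<in> E} = insert (tq p) (insert (tw p) {v \<in> V. {p, v} \<in> E})"
  using nbr_P[OF assms] triangle[OF assms] by auto

text \<open>If \<open>{p}\<close> does not give a facet, then \<open>m\<close> exhausts all the capacities at the neighbours of \<open>p\<close>.
  In that case \<open>p\<close> and the pendant vertices at its neighbours give a facet whose right hand side
  \<open>m\<close> is too large for a Gorenstein polytope.\<close>

lemma max_deg_triangle_vertex:
  fixes \<delta> :: int
  assumes refl: "reflexive ((\<lambda>v. real_of_int \<delta> *\<^sub>R v - 1) ` matching_polytope E c)" and "\<delta> > 0"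
    and c: "\<And>i. c $ i > 0"
    and M: "max_bmatching E c M" "deg M p = m" "m \<ge> 1"
    and bound: "\<And>N. max_bmatching E c N \<Longrightarrow> deg N p \<le> m"
    and p: "p \<in> P" and others: "\<And>j. j \<notin> P \<Longrightarrow> \<delta> * int (c $ j) \<ge> 2"
  shows "\<delta> * int m = 2"
proof (rule ccontr)
  assume "\<delta> * int m \<noteq> 2"
  then obtain v where v: "v \<in> V" "{p, v} \<in> E"
    and leaf_v: "\<And>N. max_bmatching E c N \<Longrightarrow> deg N p = m \<Longrightarrow> deg N (leaf v) = 0"
    using vertex_dichotomy[OF refl \<open>\<delta> > 0\<close> c M bound] by metis
  define B where "B = {l. {p, l} \<in> E}"
  have sat: "deg M l = c $ l" if "l \<in> B" for l
    using maximal_triangle_vertex(1)[OF c M(1,2) v(1) p v(2) leaf_v] that by (simp add: B_def)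
  have at_p: "p \<in> e" if "l \<in> B" "e \<in># M" "l \<in> e" for l e
    using maximal_triangle_vertex(2)[OF c M(1,2) v(1) p v(2) leaf_v] that by (simp add: B_def)
  define W where "W = {v \<in> V. {p, v} \<in> E}"
  have B: "B = insert (tq p) (insert (tw p) W)" unfolding B_def W_def by (rule nbrs_P[OF p])
  \<comment> \<open>\<open>p\<close> together with the only vertices that may be out of reach while
    \<open>p\<close> has degree \<open>m\<close>; by \<open>cover_or_leaf\<close> every other vertex
    can be covered.\<close>
  define A where "A = insert p (leaf ` W)"
  have "p \<notin> B" using loopless_edgeD[OF loopless, of p p] by (auto simp: B_def)
  have "A \<inter> B = {}" using \<open>p \<notin> B\<close> p by (auto simp: A_def B W_def)
  have "p \<in> A" by (simp add: A_def)
  \<comment> \<open>Each edge of \<open>M\<close> at a neighbour of \<open>p\<close> passes through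
    \<open>p\<close>, so the saturated capacities on \<open>B\<close> are all counted in the degree
    of \<open>p\<close>.\<close>
  have sum_B: "(\<Sum>l\<in>B. c $ l) \<le> m"
  proof -
    have "(\<Sum>l\<in>B. deg M l) \<le> (\<Sum>i\<in>{p}. deg M i)"
    proof (rule sum_deg_le, rule card_Int_le_neighbour[OF loopless])
      fix e i k assume "e \<in># M" "i \<in> B" "e = {i, k}"
      with at_p[of i e] \<open>p \<notin> B\<close> show "k \<in> {p} - B" by auto
    qed (rule max_bmatching_edge[OF M(1)])
    then show ?thesis using sat M(2) by simp
  qed
  have A_nbr: "k \<in> B - A" if "i \<in> A" "{i, k} \<in> E" for i k
  proof -
    have "k \<in> B"
    proof (cases "i = p")
      case False
      with that obtain w where "w \<in> W" "i = leaf w" by (auto simp: A_def)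
      with that nbr_leaf[of w k] show ?thesis by (auto simp: B W_def)
    qed (use that in \<open>simp add: B_def\<close>)
    with \<open>A \<inter> B = {}\<close> show ?thesis by blast
  qed
  have bound_A: "(\<Sum>i\<in>A. deg N i) \<le> m" if N: "max_bmatching E c N" for N
  proof -
    have "(\<Sum>i\<in>A. deg N i) \<le> (\<Sum>l\<in>B. deg N l)"
    proof (rule sum_deg_le, rule card_Int_le_neighbour[OF loopless])
      fix e i k assume "e \<in># N" "i \<in> A" "e = {i, k}"
      then show "k \<in> B - A" using A_nbr max_bmatching_edge[OF N] by blast
    qed (rule max_bmatching_edge[OF N])
    also have "\<dots> \<le> (\<Sum>l\<in>B. c $ l)" by (intro sum_mono max_bmatching_deg_le[OF N])
    finally show ?thesis using sum_B by simp
  qed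
  \<comment> \<open>Degree \<open>m\<close> at \<open>p\<close> alone already exhausts the
    bound.\<close>
  have tight: "(\<Sum>i\<in>A. deg N i) = m" if "max_bmatching E c N" "deg N p = m" for N
  proof -
    have "deg N p \<le> (\<Sum>i\<in>A. deg N i)" using \<open>p \<in> A\<close> by (intro member_le_sum) auto
    with that bound_A show ?thesis by force
  qed
  have "\<delta> * int m = int (card A) + 1"
  proof (rule gorenstein_indicator[OF refl[unfolded matching_polytope_def] \<open>\<delta> > 0\<close>])
    show "deg M \<in> deg ` {M. max_bmatching E c M}" using M by blast
    show "sum (deg M) A = m" using M by (intro tight)
    show "p \<in> A" by fact
    fix k
    {
      assume "k \<notin> A"
      then have "k \<noteq> p" "\<not> (\<exists>v\<in>V. k = leaf v \<and> p \<in> P \<and> {p, v} \<in> E)" by (auto simp: A_def W_def)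
      then obtain N where "max_bmatching E c N" "deg N p = m" "deg N k \<ge> 1"
        using cover_or_leaf[OF c M] by blast
      then show "\<exists>f\<in>deg ` {M. max_bmatching E c M}. sum f A = m \<and> 1 \<le> f k" using tight by blast
    next
      assume "k \<in> A" "k \<noteq> p"
      then obtain w where w: "w \<in> W" "k = leaf w" by (auto simp: A_def)
      then have "w \<in> B" "w \<in> V" "k \<noteq> w" "p \<noteq> w" using p by (auto simp: B W_def)
      have "deg M w \<ge> 1" using sat[OF \<open>w \<in> B\<close>] c[of w] by simp
      then obtain e where e: "e \<in># M" "w \<in> e" by (meson deg_pos_iff)
      then obtain u where "e = {w, u}" using loopless_edgeE[OF loopless max_bmatching_edge[OF M(1)]] by blast
      with at_p[OF \<open>w \<in> B\<close> e] \<open>p \<noteq> w\<close> have ewp: "e = {w, p}" by auto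
      \<comment> \<open>The only edge at the leaf \<open>k\<close> is \<open>{k, w}\<close>, but
        edges of \<open>M\<close> at \<open>w\<close> pass through \<open>p\<close>. Hence
        \<open>k\<close> is free, and trading \<open>{w, p}\<close> for \<open>{w, k}\<close> moves
        a unit of degree from \<open>p\<close> to \<open>k\<close>.\<close>
      have "\<not> deg M k \<ge> 1"
      proof
        assume "deg M k \<ge> 1"
        then obtain e' where e': "e' \<in># M" "k \<in> e'" by (meson deg_pos_iff)
        then obtain u where u: "e' = {k, u}" using loopless_edgeE[OF loopless max_bmatching_edge[OF M(1)]] by blast
        then have "u = w" using nbr_leaf[OF \<open>w \<in> V\<close>, of u] max_bmatching_edge[OF M(1) e'(1)] w by simp
        with u at_p[OF \<open>w \<in> B\<close> e'(1)] \<open>k \<noteq> p\<close> \<open>p \<noteq> w\<close> show False by auto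
      qed
      then have "deg M k < c $ k" using c[of k] by simp
      then have N: "max_bmatching E c (add_mset {w, k} (M - {#e#}))"
        using e w pendant_edge[OF \<open>w \<in> V\<close>] by (intro max_bmatching_exchange[OF M(1)]) auto
      let ?f = "deg (add_mset {w, k} (M - {#e#}))"
      have f: "?f i + of_bool (i \<in> {w, p}) = deg M i + of_bool (i \<in> {w, k})" for i
        using deg_exchange[OF e(1), of "{w, k}" i] ewp by simp
      have f': "?f k = deg M k + 1" "deg M p = ?f p + 1" "\<forall>i. i \<noteq> k \<longrightarrow> i \<noteq> p \<longrightarrow> ?f i = deg M i"
      proof -
        show "?f k = deg M k + 1" using f[of k] \<open>k \<noteq> p\<close> \<open>k \<noteq> w\<close> by (simp del: deg_simps)
        show "deg M p = ?f p + 1" using f[of p] \<open>k \<noteq> p\<close> \<open>p \<noteq> w\<close> by (simp del: deg_simps)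
        show "\<forall>i. i \<noteq> k \<longrightarrow> i \<noteq> p \<longrightarrow> ?f i = deg M i"
        proof (intro allI impI)
          fix i assume "i \<noteq> k" "i \<noteq> p"
          then show "?f i = deg M i" using f[of i] by (cases "i = w") (simp_all del: deg_simps)
        qed
      qed
      have "sum ?f A = sum (deg M) A"
        using \<open>k \<in> A\<close> \<open>p \<in> A\<close> \<open>k \<noteq> p\<close> f'(1,2) f'(3)[rule_format] by (rule sum_exchange)
      then have "sum ?f A = m" using tight[OF M(1,2)] by simp
      then show "\<exists>f\<in>deg ` {M. max_bmatching E c M}. \<exists>f'\<in>deg ` {M. max_bmatching E c M}.
          sum f' A = m \<and> f' k = f k + 1 \<and> f p = f' p + 1 \<and> (\<forall>i. i \<noteq> k \<longrightarrow> i \<noteq> p \<longrightarrow> f' i = f i)"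
        using f' N M(1) by (intro bexI[of _ "deg M"] bexI[of _ ?f]) (auto simp del: deg_simps)
    }
  qed (use bound_A in auto)
  moreover have "card A \<le> card W + 1" unfolding A_def
    using card_image_le[of W leaf] by (simp add: card_insert_if)
  moreover have "card B = card W + 2"
    using p by (simp add: B W_def)
  \<comment> \<open>\<open>B\<close> avoids \<open>P\<close>, so by \<open>others\<close> each of
    its \<open>card W + 2\<close> capacities is at least 2 after scaling by \<open>\<delta>\<close>.
    The facet, however, gives at most \<open>card W + 2\<close>.\<close>
  moreover have "int 2 * int (card B) \<le> \<delta> * int m"
  proof -
    have "int 2 * int (card B) = (\<Sum>l\<in>B. 2)" by simp
    also have "\<dots> \<le> (\<Sum>l\<in>B. \<delta> * int (c $ l))"
      using p by (intro sum_mono others) (auto simp: B W_def)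
    also have "\<dots> = \<delta> * int (\<Sum>l\<in>B. c $ l)" by (simp add: sum_distrib_left)
    also have "\<dots> \<le> \<delta> * int m" 
      using \<open>\<delta> > 0\<close> by (intro mult_left_mono of_nat_mono sum_B) simp
    finally show ?thesis .
  qed
  ultimately show False by linarith
qed

text \<open>The exceptional case of \<open>vertex_dichotomy\<close> requires \<open>j\<close> in
  \<open>P\<close>, so other vertices are settled directly. The clause \<open>m \<le> c $ j\<close>
  turns their result into the capacity bound that base vertices require.\<close>

lemma max_deg:
  fixes \<delta> :: int
  assumes refl: "reflexive ((\<lambda>v. real_of_int \<delta> *\<^sub>R v - 1) ` matching_polytope E c)" and "\<delta> > 0"
    and c: "\<And>i. c $ i > 0"
  shows "\<exists>m. \<delta> * int m = 2 \<and> m \<le> c $ j \<and> (\<forall>N. max_bmatching E c N \<longrightarrow> deg N j \<le> m)"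
proof -
  have outside_P: "\<exists>m. \<delta> * int m = 2 \<and> m \<le> c $ j \<and> (\<forall>N. max_bmatching E c N \<longrightarrow> deg N j \<le> m)"
    if "j \<notin> P" for j
  proof -
    obtain l where "{j, l} \<in> E" using has_nbr by blast
    then obtain m M where M: "max_bmatching E c M" "deg M j = m" "m \<ge> 1"
        "\<And>N. max_bmatching E c N \<Longrightarrow> deg N j \<le> m"
      using max_deg_obtain[OF loopless c] by blast
    have "\<delta> * int m = 2" using vertex_dichotomy[OF refl \<open>\<delta> > 0\<close> c M] that by metis
    with M max_bmatching_deg_le[OF M(1), of j] show ?thesis by blast
  qed
  show ?thesis
  proof (cases "j \<in> P")
    case True
    obtain l where "{j, l} \<in> E" using has_nbr by blast
    then obtain m M where M: "max_bmatching E c M" "deg M j = m" "m \<ge> 1"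
        "\<And>N. max_bmatching E c N \<Longrightarrow> deg N j \<le> m"
      using max_deg_obtain[OF loopless c] by blast
    have others: "\<delta> * int (c $ i) \<ge> 2" if i: "i \<notin> P" for i
    proof -
      obtain m' where m': "\<delta> * int m' = 2" "m' \<le> c $ i" using outside_P[OF i] by blast
      then have "\<delta> * int m' \<le> \<delta> * int (c $ i)" using \<open>\<delta> > 0\<close> by (intro mult_left_mono) auto
      with m'(1) show ?thesis by linarith
    qed
    have "\<delta> * int m = 2"
      by (rule max_deg_triangle_vertex[OF refl \<open>\<delta> > 0\<close> c M True]) (auto intro: others)
    with M max_bmatching_deg_le[OF M(1), of j] show ?thesis by blast
  qed (rule outside_P)
qed

subsection \<open>Matchings assembled from pendant edges and triangles\<close>

definition assemble :: "('n \<Rightarrow> 'n set multiset) \<Rightarrow> ('n \<Rightarrow> 'n set multiset) \<Rightarrow> 'n set multiset" where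
  "assemble F G = (\<Sum>v\<in>V. F v) + (\<Sum>p\<in>P. G p)"

text \<open>The pendant edges and the triangles partition the vertices, so a single summand
  contributes to each degree.\<close>

lemma deg_assemble:
  assumes F: "\<And>v i. v \<in> V \<Longrightarrow> i \<notin> {v, leaf v} \<Longrightarrow> deg (F v) i = 0"
    and G: "\<And>p i. p \<in> P \<Longrightarrow> i \<notin> {p, tq p, tw p} \<Longrightarrow> deg (G p) i = 0"
  shows "\<And>v i. v \<in> V \<Longrightarrow> i \<in> {v, leaf v} \<Longrightarrow> deg (assemble F G) i = deg (F v) i"
    and "\<And>p i. p \<in> P \<Longrightarrow> i \<in> {p, tq p, tw p} \<Longrightarrow> deg (assemble F G) i = deg (G p) i"
proof -
  fix v i assume v: "v \<in> V" "i \<in> {v, leaf v}"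
  have "(\<Sum>p\<in>P. deg (G p) i) = 0" using v by (intro sum.neutral ballI G) auto
  moreover have "(\<Sum>v'\<in>V - {v}. deg (F v') i) = 0" using v by (intro sum.neutral ballI F) auto
  ultimately show "deg (assemble F G) i = deg (F v) i"
    using v(1) by (simp add: assemble_def deg_sum sum.remove[of V v])
next
  fix p i assume p: "p \<in> P" "i \<in> {p, tq p, tw p}"
  have "(\<Sum>v\<in>V. deg (F v) i) = 0" using p by (intro sum.neutral ballI F) auto
  moreover have "(\<Sum>p'\<in>P - {p}. deg (G p') i) = 0" using p by (intro sum.neutral ballI G) auto
  ultimately show "deg (assemble F G) i = deg (G p) i"
    using p(1) by (simp add: assemble_def deg_sum sum.remove[of P p])
qed

lemma set_mset_assemble:
  "set_mset (assemble F G) = (\<Union>v\<in>V. set_mset (F v)) \<union> (\<Union>p\<in>P. set_mset (G p))"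
  by (simp add: assemble_def set_mset_sum)

definition double_matching :: "'n set multiset" where
  "double_matching = assemble (\<lambda>v. {#{v, leaf v}, {v, leaf v}#})
     (\<lambda>p. {#{p, tq p}, {p, tw p}, {tq p, tw p}#})"

lemma deg_double_matching: "deg double_matching i = 2"
proof -
  have "deg double_matching i = deg {#{v, leaf v}, {v, leaf v}#} i" if "v \<in> V" "i \<in> {v, leaf v}" for v
    unfolding double_matching_def using that by (intro deg_assemble(1)) auto
  moreover have "deg double_matching i = deg {#{p, tq p}, {p, tw p}, {tq p, tw p}#} i" if "p \<in> P" "i \<in> {p, tq p, tw p}" for p
    unfolding double_matching_def using that by (intro deg_assemble(2)) auto
  ultimately show ?thesis by (cases i rule: vertex_cases) simp_all
qed

lemma double_matching_edges: "set_mset double_matching \<subseteq> E"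
  by (auto simp: double_matching_def set_mset_assemble pendant_edge triangle)

text \<open>By the handshake identity size is half the degree sum, which is largest when all degrees
  attain the bound 2.\<close>

lemma double_matching_max:
  assumes "\<And>i. c $ i \<ge> 2" and bound: "\<And>N i. max_bmatching E c N \<Longrightarrow> deg N i \<le> 2"
  shows "max_bmatching E c double_matching"
proof -
  have D: "bmatching E c double_matching"
    using assms(1) double_matching_edges by (simp add: bmatching_def deg_double_matching)
  obtain M where M: "max_bmatching E c M" using max_bmatching_exists[OF loopless] by blast
  have "(\<Sum>i\<in>UNIV. deg M i) \<le> (\<Sum>i\<in>UNIV. deg double_matching i)"
    unfolding deg_double_matching by (intro sum_mono bound[OF M])
  then have "size M \<le> size double_matching"
    using handshake[OF loopless double_matching_edges] handshake[OF loopless, of M] M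
    by (simp add: max_bmatching_def bmatching_def)
  with D M show ?thesis unfolding max_bmatching_def using le_trans by blast
qed

lemma matching_polytope_cube:
  assumes "\<And>i. c $ i \<ge> 2" and "\<And>N i. max_bmatching E c N \<Longrightarrow> deg N i \<le> 2"
  shows "matching_polytope E c = cbox 0 2"
  unfolding matching_polytope_def
proof (rule convex_hull_down_set_cube)
  have "deg double_matching = (\<lambda>_. 2)" using deg_double_matching by blast
  then show "(\<lambda>_. 2) \<in> deg ` {M. max_bmatching E c M}"
    using double_matching_max[OF assms] by force
qed (use assms(2) in auto)

section \<open>The case of degrees at most 1\<close>

definition single_matching :: "'n set multiset" where
  "single_matching = assemble (\<lambda>v. {#{v, leaf v}#}) (\<lambda>p. {#{tq p, tw p}#})"

text \<open>Using the triangle edge opposite to the base vertex leaves exactly \<open>P\<close>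
  uncovered, so base vertices have spare capacity for exchanges.\<close>

lemma deg_single_matching: "deg single_matching i = of_bool (i \<notin> P)"
proof -
  have "deg single_matching i = deg {#{v, leaf v}#} i" if "v \<in> V" "i \<in> {v, leaf v}" for v
    unfolding single_matching_def using that by (intro deg_assemble(1)) auto
  moreover have "deg single_matching i = deg {#{tq p, tw p}#} i" if "p \<in> P" "i \<in> {p, tq p, tw p}" for p
    unfolding single_matching_def using that by (intro deg_assemble(2)) auto
  ultimately show ?thesis by (cases i rule: vertex_cases) simp_all
qed

lemma single_matching_edges: "set_mset single_matching \<subseteq> E"
  by (auto simp: single_matching_def set_mset_assemble pendant_edge triangle)

lemma size_single_matching: "size single_matching = card V + card P"
proof -
  have "size (\<Sum>a\<in>A. F a) = (\<Sum>a\<in>A. size (F a))" if "finite A" for A :: "'n set" and F :: "'n \<Rightarrow> 'n set multiset"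
    using that by (induction A rule: finite_induct) auto
  then show ?thesis by (simp add: single_matching_def assemble_def)
qed

definition triangle_edges :: "'n \<Rightarrow> 'n set multiset \<Rightarrow> nat" where
  "triangle_edges p M = size (filter_mset (\<lambda>e. e \<subseteq> {p, tq p, tw p}) M)"

lemma edge_V_or_triangle:
  assumes "e \<in> E"
  shows "e \<inter> V \<noteq> {} \<or> (\<exists>p\<in>P. e \<subseteq> {p, tq p, tw p})"
proof -
  have "card e = 2" using assms loopless by (simp add: loopless_def)
  then obtain i j where e: "e = {i, j}" by (auto simp: card_2_iff)
  with assms have ij: "{i, j} \<in> E" by simp
  show ?thesis
  proof (cases i rule: vertex_cases)
    case (2 v)
    with nbr_leaf[of v j] ij e show ?thesis by auto
  next
    case (3 p)
    with nbr_P[of p j] ij e show ?thesis by auto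
  next
    case (4 p)
    with nbr_tq[of p j] ij e show ?thesis by blast
  next
    case (5 p)
    with nbr_tw[of p j] ij e show ?thesis by blast
  qed (auto simp: e)
qed

text \<open>Each edge meets \<open>V\<close> or lies in a triangle. When degrees are at most 1 this
  yields the bound \<open>card V + card P\<close>, which \<open>single_matching\<close>
  attains.\<close>

lemma size_le_triangle_edges:
  "set_mset M \<subseteq> E \<Longrightarrow> size M \<le> (\<Sum>v\<in>V. deg M v) + (\<Sum>p\<in>P. triangle_edges p M)"
proof (induction M)
  case (add e M)
  have "1 \<le> (\<Sum>v\<in>V. of_bool (v \<in> e)) + (\<Sum>p\<in>P. of_bool (e \<subseteq> {p, tq p, tw p}) :: nat)"
  proof (cases "e \<inter> V = {}")
    case True
    then obtain p where "p \<in> P" "e \<subseteq> {p, tq p, tw p}" using edge_V_or_triangle[of e] add.prems by auto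
    then have "of_bool (e \<subseteq> {p, tq p, tw p}) \<le> (\<Sum>p\<in>P. of_bool (e \<subseteq> {p, tq p, tw p}) :: nat)"
      by (intro member_le_sum) auto
    with \<open>e \<subseteq> {p, tq p, tw p}\<close> show ?thesis by simp
  next
    case False
    then obtain v where "v \<in> V" "v \<in> e" by blast
    then have "of_bool (v \<in> e) \<le> (\<Sum>v\<in>V. of_bool (v \<in> e) :: nat)"
      by (intro member_le_sum) auto
    with \<open>v \<in> e\<close> show ?thesis by simp
  qed
  moreover have "triangle_edges p (add_mset e M) = of_bool (e \<subseteq> {p, tq p, tw p}) + triangle_edges p M" for p
    by (simp add: triangle_edges_def del: insert_subset subset_insert)
  ultimately show ?case using add by (simp add: sum.distrib del: of_bool_eq_1_iff)
qed simp

text \<open>Two edges inside a triangle would need degree sum 4 on three vertices.\<close>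

lemma triangle_edges_le_1:
  assumes "set_mset M \<subseteq> E" "\<And>i. deg M i \<le> 1"
  shows "triangle_edges p M \<le> 1"
proof -
  let ?T = "{p, tq p, tw p}"
  have "2 * triangle_edges p M \<le> (\<Sum>e\<in>#M. card (e \<inter> ?T))"
    using assms(1)
  proof (induction M)
    case (add e M)
    then have "card e = 2" using loopless by (auto simp: loopless_def)
    then have "e \<subseteq> ?T \<Longrightarrow> card (e \<inter> ?T) = 2" by (simp add: Int_absorb2)
    with add show ?case by (auto simp: triangle_edges_def)
  qed (simp add: triangle_edges_def)
  also have "\<dots> = (\<Sum>i\<in>?T. deg M i)" by (simp only: sum_deg finite)
  also have "\<dots> \<le> (\<Sum>i\<in>?T. 1)" by (intro sum_mono assms(2))
  also have "\<dots> \<le> 3" by (simp add: card_insert_if)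
  finally show ?thesis by simp
qed

lemma single_matching_max:
  assumes c: "\<And>i. c $ i > 0" and bound: "\<And>N i. max_bmatching E c N \<Longrightarrow> deg N i \<le> 1"
  shows "max_bmatching E c single_matching"
proof -
  have D: "bmatching E c single_matching"
    using c single_matching_edges by (auto simp: bmatching_def deg_single_matching Suc_le_eq)
  obtain M where M: "max_bmatching E c M" using max_bmatching_exists[OF loopless] by blast
  then have ME: "set_mset M \<subseteq> E" by (simp add: max_bmatching_def bmatching_def)
  have "(\<Sum>v\<in>V. deg M v) \<le> (\<Sum>v\<in>V. 1)" by (intro sum_mono bound[OF M])
  moreover have "(\<Sum>p\<in>P. triangle_edges p M) \<le> (\<Sum>p\<in>P. 1)"
    by (intro sum_mono triangle_edges_le_1[OF ME bound[OF M]])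
  ultimately have "size M \<le> size single_matching"
    using size_le_triangle_edges[OF ME] by (simp add: size_single_matching)
  with D M show ?thesis unfolding max_bmatching_def using le_trans by blast
qed

text \<open>Here a triangle together with the pendant vertices at the neighbours of its base vertex
  gives the facet that violates the Gorenstein condition.\<close>

lemma not_reflexive_2:
  assumes refl: "reflexive ((\<lambda>v. real_of_int 2 *\<^sub>R v - 1) ` matching_polytope E c)"
    and c: "\<And>i. c $ i > 0" and bound: "\<And>N i. max_bmatching E c N \<Longrightarrow> deg N i \<le> 1"
  shows False
proof -
  let ?S = single_matching
  have S: "max_bmatching E c ?S" by (rule single_matching_max[OF c bound])
  obtain p where p: "p \<in> P" using nonempty by blast
  define W where "W = {v \<in> V. {p, v} \<in> E}"
  have "W \<noteq> {}" using connected[OF p] by (auto simp: W_def)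
  have WV: "W \<subseteq> V" by (auto simp: W_def)
  let ?T = "{p, tq p, tw p}"
  define A where "A = ?T \<union> leaf ` W"
  have disj: "?T \<inter> leaf ` W = {}" using WV p by auto
  have inj_W: "inj_on leaf W" using inj(1) WV by (rule inj_on_subset)
  have card_T: "card ?T = 3" using p by simp
  have card_A: "card A = 3 + card W"
    using card_Un_disjoint[OF finite finite disj] card_T
    by (simp only: A_def card_image[OF inj_W])
  have tight: "sum (deg ?S) A = 2 + card W"
  proof -
    have "sum (deg ?S) A = sum (deg ?S) ?T + sum (deg ?S) (leaf ` W)"
      unfolding A_def using disj by (intro sum.union_disjoint) auto
    also have "sum (deg ?S) ?T = 2" using p by (simp add: deg_single_matching)
    also have "sum (deg ?S) (leaf ` W) = (\<Sum>v\<in>W. 1)"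
      unfolding sum.reindex[OF inj_W] using WV by (intro sum.cong) (auto simp: deg_single_matching)
    finally show ?thesis by simp
  qed
  have bound_A: "sum (deg N) A \<le> 2 + card W" if N: "max_bmatching E c N" for N
  proof -
    have NE: "set_mset N \<subseteq> E" using N by (simp add: max_bmatching_def bmatching_def)
    \<comment> \<open>An edge inside the triangle counts twice, but only one fits. Any other edge
      that meets \<open>A\<close> does so once and has its other end in \<open>W\<close>.\<close>
    have le: "card (e \<inter> A) \<le> card (e \<inter> W) + 2 * of_bool (e \<subseteq> ?T)" if e: "e \<in> E" for e
    proof (cases "e \<subseteq> ?T")
      case True
      have "card e = 2" using e loopless by (simp add: loopless_def)
      then have "card (e \<inter> A) \<le> 2" by (metis card_mono finite Int_lower1)
      with True show ?thesis by simp
    next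
      case False
      have "card (e \<inter> A) \<le> card (e \<inter> W)"
      proof (rule card_Int_le_neighbour[OF loopless e])
        fix i k assume i: "i \<in> A" "e = {i, k}"
        then have ik: "{i, k} \<in> E" using e by simp
        have "k \<in> W"
        proof (cases "i \<in> ?T")
          case True
          with False i have "k \<notin> ?T" by auto
          with True show ?thesis using nbr_P[OF p, of k] nbr_tq[OF p, of k] nbr_tw[OF p, of k] ik
            by (auto simp: W_def)
        next
          case False
          with i obtain w where "w \<in> W" "i = leaf w" by (auto simp: A_def)
          with nbr_leaf[of w k] ik WV show ?thesis by auto
        qed
        moreover from this have "k \<notin> A" using p by (auto simp: A_def W_def)
        ultimately show "k \<in> W - A" by blast
      qed
      then show ?thesis by simp
    qed
    have "(\<Sum>e\<in>#N. card (e \<inter> A)) \<le> (\<Sum>e\<in>#N. card (e \<inter> W) + 2 * of_bool (e \<subseteq> ?T))"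
      by (rule sum_mset_mono, rule le) (use NE in blast)
    also have "\<dots> = (\<Sum>i\<in>W. deg N i) + 2 * triangle_edges p N"
    proof -
      have "(\<Sum>e\<in>#K. card (e \<inter> W) + 2 * of_bool (e \<subseteq> ?T)) = (\<Sum>e\<in>#K. card (e \<inter> W)) + 2 * triangle_edges p K"
        for K by (induction K) (auto simp: triangle_edges_def)
      then show ?thesis by (simp only: sum_deg finite)
    qed
    also have "\<dots> \<le> (\<Sum>i\<in>W. 1) + 2 * 1"
      by (intro add_mono sum_mono mult_le_mono triangle_edges_le_1 bound[OF N] NE) auto
    finally show ?thesis by (simp add: sum_deg)
  qed
  \<comment> \<open>Trading \<open>{j, k}\<close> for \<open>{i, k}\<close> moves one unit of degree
    from \<open>j\<close> to the uncovered base vertex \<open>i\<close>.\<close>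
  have swap: "max_bmatching E c (add_mset {i, k} (?S - {#{j, k}#})) \<and>
      (\<forall>l. deg (add_mset {i, k} (?S - {#{j, k}#})) l + of_bool (l = j) = deg ?S l + of_bool (l = i))"
    if "{j, k} \<in># ?S" "{i, k} \<in> E" "i \<in> P" "i \<noteq> k" "j \<noteq> k" for i j k
  proof
    show "max_bmatching E c (add_mset {i, k} (?S - {#{j, k}#}))"
      using that c by (intro max_bmatching_exchange[OF S that(1,2)]) (auto simp: deg_single_matching)
    show "\<forall>l. deg (add_mset {i, k} (?S - {#{j, k}#})) l + of_bool (l = j) = deg ?S l + of_bool (l = i)"
    proof
      fix l
      show "deg (add_mset {i, k} (?S - {#{j, k}#})) l + of_bool (l = j) = deg ?S l + of_bool (l = i)"
        using deg_exchange[OF that(1), of "{i, k}" l] that(4,5) by (cases "l = k") (simp_all del: deg_simps)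
    qed
  qed
  have in_S: "v \<in> V \<Longrightarrow> {v, leaf v} \<in># ?S" "p' \<in> P \<Longrightarrow> {tq p', tw p'} \<in># ?S" for v p'
    by (auto simp: single_matching_def set_mset_assemble)
  have "2 * int (2 + card W) = int (card A) + 1"
  proof (rule gorenstein_indicator[OF refl[unfolded matching_polytope_def]])
    show "p \<in> A" by (simp add: A_def)
    show "deg ?S \<in> deg ` {M. max_bmatching E c M}" using S by blast
    fix k
    {
      assume k: "k \<notin> A"
      show "\<exists>f\<in>deg ` {M. max_bmatching E c M}. sum f A = 2 + card W \<and> 1 \<le> f k"
      proof (cases "k \<in> P")
        case True
        then have kp: "k \<noteq> p" using k by (auto simp: A_def)
        \<comment> \<open>Another base vertex is covered within its own triangle: the unit moves
          from \<open>tq k\<close> to \<open>k\<close>, both outside \<open>A\<close>, so the sum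
          over \<open>A\<close> is unchanged.\<close>
        let ?N = "add_mset {k, tw k} (?S - {#{tq k, tw k}#})"
        have N: "max_bmatching E c ?N"
          and deg: "\<And>l. deg ?N l + of_bool (l = tq k) = deg ?S l + of_bool (l = k)"
          using swap[of "tq k" "tw k" k] in_S(2)[OF True] triangle(2)[OF True] True by auto
        have "tq k \<notin> A" using True p kp WV by (auto simp: A_def)
        have "sum (deg ?N) A = sum (deg ?S) A"
        proof (rule sum.cong[OF HOL.refl])
          fix l assume "l \<in> A"
          then have "l \<noteq> k" "l \<noteq> tq k" using k \<open>tq k \<notin> A\<close> by auto
          then show "deg ?N l = deg ?S l" using deg[of l] by (simp del: deg_simps)
        qed
        moreover have "deg ?N k \<ge> 1" by simp
        ultimately show ?thesis using N tight by (intro bexI[of _ "deg ?N"]) (auto simp del: deg_simps)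
      next
        case False
        then show ?thesis using S tight by (intro bexI[of _ "deg ?S"]) (auto simp: deg_single_matching)
      qed
    next
      assume k: "k \<in> A" "k \<noteq> p"
      \<comment> \<open>\<open>m\<close> is the partner of \<open>k\<close> in the single matching:
        the remaining corner of the triangle, or the vertex of \<open>W\<close> carrying the leaf
        \<open>k\<close>. In each case it is adjacent to \<open>p\<close>.\<close>
      obtain m where m: "{k, m} \<in># ?S" "{p, m} \<in> E" "p \<noteq> m" "k \<noteq> m"
      proof -
        consider "k = tq p" | "k = tw p" | w where "w \<in> W" "k = leaf w" using k by (auto simp: A_def)
        then show thesis
        proof cases
          case 1
          then show thesis using that[of "tw p"] in_S(2)[OF p] triangle(2)[OF p] p by simp
        next
          case 2
          then show thesis using that[of "tq p"] in_S(2)[OF p] triangle(1)[OF p] p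
            by (simp add: insert_commute)
        next
          case (3 w)
          then show thesis using that[of w] in_S(1)[of w] p by (auto simp: insert_commute W_def)
        qed
      qed
      let ?N = "add_mset {p, m} (?S - {#{k, m}#})"
      have N: "max_bmatching E c ?N"
        and deg: "\<And>l. deg ?N l + of_bool (l = k) = deg ?S l + of_bool (l = p)"
        using swap[OF m(1,2) p m(3,4)] by auto
      have "deg ?S k = deg ?N k + 1" "deg ?N p = deg ?S p + 1"
        using deg[of k] deg[of p] k(2) by (simp_all del: deg_simps)
      moreover have "deg ?S i = deg ?N i" if "i \<noteq> k" "i \<noteq> p" for i
        using deg[of i] that by (simp del: deg_simps)
      ultimately show "\<exists>f\<in>deg ` {M. max_bmatching E c M}. \<exists>f'\<in>deg ` {M. max_bmatching E c M}.
          sum f' A = 2 + card W \<and> f' k = f k + 1 \<and> f p = f' p + 1 \<and> (\<forall>i. i \<noteq> k \<longrightarrow> i \<noteq> p \<longrightarrow> f' i = f i)"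
        using S N tight by (intro bexI[of _ "deg ?N"] bexI[of _ "deg ?S"]) (auto simp del: deg_simps)
    }
  qed (use bound_A tight in auto)
  \<comment> \<open>The facet equation reads \<open>2 * (card W + 2) = card W + 4\<close>, which
    would force \<open>W\<close> to be empty.\<close>
  moreover have "card W > 0" using \<open>W \<noteq> {}\<close> by (simp add: card_gt_0_iff)
  ultimately show False using card_A by simp
qed

section \<open>The Gorenstein matching polytopes\<close>

lemma gorenstein_imp_cube:
  assumes "gorenstein (matching_polytope E c)" and c: "\<And>i. c $ i > 0"
  shows "matching_polytope E c = cbox 0 2"
proof -
  obtain \<delta> :: int and a where \<delta>: "\<delta> > 0" and a: "lattice_point a"
    and refl_a: "reflexive ((\<lambda>v. real_of_int \<delta> *\<^sub>R v - a) ` matching_polytope E c)"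
    using assms(1) by (auto simp: gorenstein_def)
  have "\<exists>f\<in>deg ` {M. max_bmatching E c M}. f j \<ge> 1" for j
  proof -
    obtain l where "{j, l} \<in> E" using has_nbr by blast
    from max_bmatching_cover_vertex[OF loopless c this] show ?thesis by blast
  qed
  then have "a = 1"
    by (rule gorenstein_translation[OF refl_a[unfolded matching_polytope_def] \<delta> a])
  with refl_a have refl: "reflexive ((\<lambda>v. real_of_int \<delta> *\<^sub>R v - 1) ` matching_polytope E c)" by simp
  note deg = max_deg[OF refl \<delta> c]
  obtain m where "\<delta> * int m = 2" using deg by blast
  then have "\<delta> dvd 2" by (metis dvd_triv_left)
  with \<delta> have "\<delta> \<le> 2" by (simp add: zdvd_imp_le)
  with \<delta> consider "\<delta> = 1" | "\<delta> = 2" by linarith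
  then show ?thesis
  proof cases
    case 1
    \<comment> \<open>For \<open>\<delta> = 1\<close> the largest degree is 2, and since it never
      exceeds the capacity, every capacity is at least 2 and admits the double matching.\<close>
    then have m: "2 \<le> c $ j \<and> (\<forall>N. max_bmatching E c N \<longrightarrow> deg N j \<le> 2)" for j
      using deg[of j] by auto
    show ?thesis by (rule matching_polytope_cube) (use m in auto)
  next
    case 2
    then have m: "\<forall>N. max_bmatching E c N \<longrightarrow> deg N j \<le> 1" for j
      using deg[of j] by auto
    have False by (rule not_reflexive_2[OF refl[unfolded 2] c]) (use m in auto)
    then show ?thesis ..
  qed
qed

lemma matching_polytope_2: "matching_polytope E (\<chi> i. 2) = cbox 0 2"
  using max_bmatching_deg_le by (intro matching_polytope_cube) fastforce+

lemma convex_hull_exponent_vectors: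
  assumes "\<And>i. c $ i > 0"
  shows "convex hull (exponent_vectors TYPE('k::field) E c) = matching_polytope E c"
proof -
  obtain j l where "{j, l} \<in> E" using has_nbr by blast
  then obtain M where "max_bmatching E c M" "deg M j \<ge> 1"
    using max_bmatching_cover_vertex[OF loopless assms] by blast
  then have "max_bmatching E c M" "M \<noteq> {#}" by auto
  then show ?thesis
    unfolding matching_polytope_def by (simp add: exponent_vectors_eq[OF loopless])
qed

theorem gorenstein_polytopes:
  "{Q :: (real ^ 'n) set. gorenstein Q \<and>
      (\<exists>c :: nat ^ 'n. (\<forall>i. c $ i > 0) \<and> Q = convex hull (exponent_vectors TYPE('k::field) E c))}
    = {(\<lambda>v. v + 1) ` centred_cube}"
proof -
  \<comment> \<open>Constant capacity 2 makes the degree bound of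
    \<open>matching_polytope_cube\<close> automatic, so the cube occurs.\<close>
  have "convex hull (exponent_vectors TYPE('k) E (\<chi> i. 2)) = cbox 0 2"
    by (simp add: convex_hull_exponent_vectors matching_polytope_2)
  moreover have "\<forall>i. ((\<chi> i. 2) :: nat ^ 'n) $ i > 0" by simp
  ultimately have "\<exists>c :: nat ^ 'n. (\<forall>i. c $ i > 0) \<and> cbox 0 2 = convex hull (exponent_vectors TYPE('k) E c)"
    by metis
  then show ?thesis
    unfolding centred_cube_translation
    using gorenstein_cube gorenstein_imp_cube convex_hull_exponent_vectors[where 'k = 'k] by auto
qed

end

subsection \<open>The Cohen--Macaulay Cameron--Walker graphs\<close>

text \<open>A necessary condition for adjacency of the vertices with indices \<open>i < j\<close>: the graph \<open>H\<close> is
  replaced by the complete bipartite graph on its classes.\<close>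

definition cw_adj :: "nat \<Rightarrow> nat \<Rightarrow> nat \<Rightarrow> nat \<Rightarrow> bool" where
  "cw_adj r s i j \<longleftrightarrow>
     i \<in> {1..r} \<and> (j \<in> {2 * r + 1..2 * r + s} \<or> j = r + i) \<or>
     i \<in> {2 * r + 1..2 * r + s} \<and> (j = i + s \<or> j = i + 2 * s) \<or>
     i \<in> {2 * r + s + 1..2 * r + 2 * s} \<and> j = i + s"

lemma cw_adj_bounds:
  "cw_adj r s i j \<Longrightarrow> i \<in> {1..2 * r + 3 * s} \<and> j \<in> {1..2 * r + 3 * s} \<and> i < j"
  by (auto simp: cw_adj_def)

lemma connected_bipartite_edge:
  assumes "connected_bipartite A B H" "e \<in> H"
  obtains a b where "a \<in> A" "b \<in> B" "e = {a, b}"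
proof -
  have "\<exists>a\<in>A. \<exists>b\<in>B. e = {a, b}" using assms by (simp add: connected_bipartite_def)
  with that show ?thesis by blast
qed

lemma cameron_walker_edge:
  assumes H: "connected_bipartite (x ` {1..r}) (x ` {2 * r+1..2 * r+s}) H"
    and "e \<in> cameron_walker x r s H"
  shows "\<exists>i j. e = {x i, x j} \<and> cw_adj r s i j"
proof -
  from assms(2) consider "e \<in> H"
    | i where "i \<in> {1..r}" "e = {x i, x (r + i)}"
    | i where "i \<in> {1..s}" "e = {x (2 * r + i), x (2 * r + s + i)}"
    | i where "i \<in> {1..s}" "e = {x (2 * r + i), x (2 * r + 2 * s + i)}"
    | i where "i \<in> {1..s}" "e = {x (2 * r + s + i), x (2 * r + 2 * s + i)}"
    unfolding cameron_walker_def by blast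
  then show ?thesis
  proof cases
    case 1
    obtain a b where "a \<in> x ` {1..r}" "b \<in> x ` {2 * r+1..2 * r+s}" "e = {a, b}"
      by (rule connected_bipartite_edge[OF H 1])
    then obtain i j where "i \<in> {1..r}" "j \<in> {2 * r+1..2 * r+s}" "e = {x i, x j}" by blast
    then show ?thesis by (intro exI[of _ i] exI[of _ j]) (simp add: cw_adj_def)
  next
    case (2 i)
    then show ?thesis by (intro exI[of _ i] exI[of _ "r + i"]) (simp add: cw_adj_def)
  next
    case (3 i)
    then show ?thesis by (intro exI[of _ "2 * r + i"] exI[of _ "2 * r + s + i"]) (simp add: cw_adj_def)
  next
    case (4 i)
    then show ?thesis by (intro exI[of _ "2 * r + i"] exI[of _ "2 * r + 2 * s + i"]) (simp add: cw_adj_def)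
  next
    case (5 i)
    then show ?thesis by (intro exI[of _ "2 * r + s + i"] exI[of _ "2 * r + 2 * s + i"]) (simp add: cw_adj_def)
  qed
qed

text \<open>A walk from \<open>b\<close> to a vertex of the other class has a first step, which ends
  in \<open>A\<close> because the graph is bipartite.\<close>

lemma connected_bipartite_has_nbr:
  assumes "connected_bipartite A B H" "A \<noteq> {}" "b \<in> B"
  shows "\<exists>a\<in>A. {b, a} \<in> H"
proof -
  obtain a where "a \<in> A" using assms(2) by blast
  with assms have "(b, a) \<in> {(a, b). {a, b} \<in> H}\<^sup>*" "b \<noteq> a"
    by (auto simp: connected_bipartite_def)
  then obtain k where bk: "{b, k} \<in> H" by (auto elim: converse_rtranclE)
  obtain a' b' where "a' \<in> A" "b' \<in> B" "{b, k} = {a', b'}"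
    by (rule connected_bipartite_edge[OF assms(1) bk])
  moreover have "b \<notin> A" using assms(1,3) by (auto simp: connected_bipartite_def)
  ultimately have "k \<in> A" by (auto simp: doubleton_eq_iff)
  with bk show ?thesis by blast
qed

text \<open>The locale needs functions on vertices, so \<open>idx\<close> recovers the index of a
  vertex and the pendant partners arise by shifting it by \<open>r\<close>, \<open>s\<close> and
  \<open>2 * s\<close>.\<close>

lemma pendant_graph_cameron_walker:
  fixes x :: "nat \<Rightarrow> 'n::finite"
  assumes rs: "1 \<le> r" "1 \<le> s"
    and x: "bij_betw x {1..2 * r + 3 * s} (UNIV :: 'n set)"
    and H: "connected_bipartite (x ` {1..r}) (x ` {2 * r+1..2 * r+s}) H"
  defines "idx \<equiv> the_inv_into {1..2 * r + 3 * s} x"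
  shows "pendant_graph (x ` {1..r}) (x ` {2 * r+1..2 * r+s}) (\<lambda>u. x (r + idx u))
    (\<lambda>u. x (s + idx u)) (\<lambda>u. x (2 * s + idx u)) (cameron_walker x r s H)"
proof -
  let ?I = "{1..2 * r + 3 * s}" and ?E = "cameron_walker x r s H"
  have inj: "inj_on x ?I" using x by (rule bij_betw_imp_inj_on)
  have idx [simp]: "idx (x i) = i" if "i \<in> ?I" for i
    unfolding idx_def using inj that by (rule the_inv_into_f_f)
  have eq: "x i = x j \<longleftrightarrow> i = j" if "i \<in> ?I" "j \<in> ?I" for i j
    using inj that by (rule inj_on_eq_iff)
  have vertex: "\<exists>j\<in>?I. k = x j" for k using x by (metis UNIV_I bij_betw_def imageE)
  \<comment> \<open>Injectivity of \<open>x\<close> reduces adjacency to arithmetic on indices; both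
    orders occur because an edge is an unordered pair.\<close>
  have adj: "cw_adj r s i j \<or> cw_adj r s j i" if ij: "i \<in> ?I" "j \<in> ?I" "{x i, x j} \<in> ?E" for i j
  proof -
    obtain i' j' where e: "{x i, x j} = {x i', x j'}" "cw_adj r s i' j'"
      using cameron_walker_edge[OF H ij(3)] by blast
    with cw_adj_bounds[OF e(2)] ij show ?thesis by (auto simp: doubleton_eq_iff eq)
  qed
  have adjE: "\<exists>j\<in>?I. k = x j \<and> (cw_adj r s i j \<or> cw_adj r s j i)" if i: "i \<in> ?I" "{x i, k} \<in> ?E" for i k
    using vertex[of k] adj[of i] i by blast
  have edges: "{x i, x (r + i)} \<in> ?E" if "i \<in> {1..r}" for i
    using that unfolding cameron_walker_def by blast
  have triangles: "{x i, x (s + i)} \<in> ?E" "{x i, x (2 * s + i)} \<in> ?E" "{x (s + i), x (2 * s + i)} \<in> ?E"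
    if "i \<in> {2 * r+1..2 * r+s}" for i
  proof -
    define k where "k = i - 2 * r"
    have k: "k \<in> {1..s}" "i = 2 * r + k" using that by (auto simp: k_def)
    then have shift: "s + i = 2 * r + s + k" "2 * s + i = 2 * r + 2 * s + k" by auto
    show "{x i, x (s + i)} \<in> ?E" "{x i, x (2 * s + i)} \<in> ?E" "{x (s + i), x (2 * s + i)} \<in> ?E"
      unfolding shift unfolding k(2) cameron_walker_def using k(1) by blast+
  qed
  have leaf_img: "(\<lambda>u. x (r + idx u)) ` x ` {1..r} = x ` {r+1..2 * r}"
  proof -
    have "(\<lambda>u. x (r + idx u)) ` x ` {1..r} = x ` (\<lambda>i. i + r) ` {1..r}"
      unfolding image_image by (rule image_cong) (auto simp: add.commute)
    then show ?thesis unfolding image_add_atLeastAtMost' by (simp add: add.commute mult_2)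
  qed
  have tri_img: "(\<lambda>u. x (t + idx u)) ` x ` {2 * r+1..2 * r+s} = x ` {2 * r+1+t..2 * r+s+t}" for t
  proof -
    have "(\<lambda>u. x (t + idx u)) ` x ` {2 * r+1..2 * r+s} = x ` (\<lambda>i. i + t) ` {2 * r+1..2 * r+s}"
      unfolding image_image by (rule image_cong) (auto simp: add.commute)
    then show ?thesis unfolding image_add_atLeastAtMost' .
  qed
  have disj: "x ` {a..b} \<inter> x ` {a'..b'} = {}"
    if "b < a' \<or> b' < a" "{a..b} \<subseteq> ?I" "{a'..b'} \<subseteq> ?I" for a b a' b'
    using that inj_on_image_Int[OF inj that(2,3)] by auto
  show ?thesis
  proof
    show "loopless ?E" unfolding loopless_def
    proof
      fix e assume "e \<in> ?E"
      then obtain i j where "e = {x i, x j}" "cw_adj r s i j" using cameron_walker_edge[OF H] by blast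
      with cw_adj_bounds[of r s i j] show "card e = 2" by (simp add: eq)
    qed
    show "x ` {1..r} \<noteq> {}" "x ` {2 * r+1..2 * r+s} \<noteq> {}" using rs by auto
    have "?I = {1..r} \<union> {r+1..2 * r} \<union> {2 * r+1..2 * r+s} \<union> {2 * r+1+s..2 * r+s+s} \<union>
        {2 * r+1+2 * s..2 * r+s+2 * s}" by auto
    then show "UNIV = x ` {1..r} \<union> (\<lambda>u. x (r + idx u)) ` x ` {1..r} \<union> x ` {2 * r+1..2 * r+s} \<union>
        (\<lambda>u. x (s + idx u)) ` x ` {2 * r+1..2 * r+s} \<union> (\<lambda>u. x (2 * s + idx u)) ` x ` {2 * r+1..2 * r+s}"
      using x unfolding leaf_img tri_img bij_betw_def by (metis image_Un)
    show "inj_on (\<lambda>u. x (r + idx u)) (x ` {1..r})" "inj_on (\<lambda>u. x (s + idx u)) (x ` {2 * r+1..2 * r+s})"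
      "inj_on (\<lambda>u. x (2 * s + idx u)) (x ` {2 * r+1..2 * r+s})"
      by (auto simp: inj_on_def eq)
    show "\<exists>v\<in>x ` {1..r}. {p, v} \<in> ?E" if "p \<in> x ` {2 * r+1..2 * r+s}" for p
      using connected_bipartite_has_nbr[OF H _ that] rs unfolding cameron_walker_def by auto
  next
    fix v assume "v \<in> x ` {1..r}"
    then obtain i where i: "i \<in> {1..r}" "v = x i" by blast
    then have I: "i \<in> ?I" "r + i \<in> ?I" by auto
    show "{v, x (r + idx v)} \<in> ?E" using edges[OF i(1)] i(2) I by simp
    fix k
    show "k = x (r + idx v) \<or> k \<in> x ` {2 * r+1..2 * r+s}" if e: "{v, k} \<in> ?E"
    proof -
      obtain j where "j \<in> ?I" "k = x j" "cw_adj r s i j \<or> cw_adj r s j i"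
        using adjE[OF I(1)] e i(2) by blast
      with i I show ?thesis by (auto simp: cw_adj_def)
    qed
    show "k = v" if e: "{x (r + idx v), k} \<in> ?E"
    proof -
      have "{x (r + i), k} \<in> ?E" using e i(2) I by simp
      from adjE[OF I(2) this] obtain j where "j \<in> ?I" "k = x j" "cw_adj r s (r + i) j \<or> cw_adj r s j (r + i)"
        by blast
      with i I show ?thesis by (auto simp: cw_adj_def)
    qed
  next
    fix p assume "p \<in> x ` {2 * r+1..2 * r+s}"
    then obtain i where i: "i \<in> {2 * r+1..2 * r+s}" "p = x i" by blast
    then have I: "i \<in> ?I" "s + i \<in> ?I" "2 * s + i \<in> ?I" by auto
    show "{p, x (s + idx p)} \<in> ?E" "{p, x (2 * s + idx p)} \<in> ?E" "{x (s + idx p), x (2 * s + idx p)} \<in> ?E"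
      using triangles[OF i(1)] i(2) I by simp_all
    fix k
    show "k = x (s + idx p) \<or> k = x (2 * s + idx p) \<or> k \<in> x ` {1..r}" if e: "{p, k} \<in> ?E"
    proof -
      obtain j where "j \<in> ?I" "k = x j" "cw_adj r s i j \<or> cw_adj r s j i"
        using adjE[OF I(1)] e i(2) by blast
      with i I show ?thesis by (auto simp: cw_adj_def add.commute)
    qed
    show "k = p \<or> k = x (2 * s + idx p)" if e: "{x (s + idx p), k} \<in> ?E"
    proof -
      have "{x (s + i), k} \<in> ?E" using e i(2) I by simp
      from adjE[OF I(2) this] obtain j where "j \<in> ?I" "k = x j" "cw_adj r s (s + i) j \<or> cw_adj r s j (s + i)"
        by blast
      moreover from this have "j = i \<or> j = 2 * s + i" using i by (auto simp: cw_adj_def)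
      ultimately show ?thesis using i I by auto
    qed
    show "k = p \<or> k = x (s + idx p)" if e: "{x (2 * s + idx p), k} \<in> ?E"
    proof -
      have "{x (2 * s + i), k} \<in> ?E" using e i(2) I by simp
      from adjE[OF I(3) this] obtain j where "j \<in> ?I" "k = x j" "cw_adj r s (2 * s + i) j \<or> cw_adj r s j (2 * s + i)"
        by blast
      moreover from this have "j = i \<or> j = s + i" using i by (auto simp: cw_adj_def)
      ultimately show ?thesis using i I by auto
    qed
  qed (unfold leaf_img tri_img, (rule disj; use rs in auto)+)
qed

theorem theorem9p3:
  fixes x :: "nat \<Rightarrow> 'n::finite" and r s :: nat and H :: "'n set set"
  assumes "1 \<le> r" and "1 \<le> s"
    and "bij_betw x {1..2 * r + 3 * s} (UNIV :: 'n set)"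
    and "connected_bipartite (x ` {1..r}) (x ` {2 * r+1..2 * r+s}) H"
  shows "{P :: (real ^ 'n) set. gorenstein P \<and>
            (\<exists>c :: nat ^ 'n. (\<forall>i. c $ i > 0) \<and>
               P = convex hull (exponent_vectors TYPE('k::field) (cameron_walker x r s H) c))}
         = {(\<lambda>v. v + 1) ` centred_cube}"
  by (rule pendant_graph.gorenstein_polytopes[OF pendant_graph_cameron_walker[OF assms]])

end
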